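(* Let $\pi$ be an $\mathcal{S}$-smooth spectral measure on $(\Sigma,\mathscr{A},\mu)$, and let $(\Phi_n)_{n\geq 1}\subset \mathcal{S}^*$ be a sequence of Bernoulli generalized functionals. Suppose that the following conditions are satisfied: (1) $\Phi_n$ converges weakly to some $\Phi_0\in \mathcal{S}^*$ as $n\rightarrow \infty$, namely $\lim_{n\to \infty}\langle\!\langle\Phi_n, \xi\rangle\!\rangle = \langle\!\langle\Phi_0, \xi\rangle\!\rangle$ for all $\xi\in \mathcal{S}$; (2) $(\Phi_n)_{n\geq 1}$ is uniformly integrable with respect to $\pi$. Then $\Phi_0$ is also integrable with respect to $\pi$. Moreover, for all $\xi\in \mathcal{S}$, $\big(\int_{\Sigma}\Phi_n\,d\pi\big)\xi$ converges strongly (i.e. in the strong topology of $\mathcal{S}^*$) to $\big(\int_{\Sigma}\Phi_0\,d\pi\big)\xi$ as $n\rightarrow \infty$.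
   Context: $\mathbb{N}=\{0,1,2,\dots\}$ and $\Gamma$ is the set of all finite subsets of $\mathbb{N}$. Bernoulli space: $\Sigma=\{-1,1\}^{\mathbb{N}}$, $\zeta_n(\omega)=\omega(n)$ for $\omega\in\Sigma$, $\mathscr{A}$ is the $\sigma$-field generated by $(\zeta_n)_{n\ge 0}$, $(\theta_n)_{n\ge0}$ is a given sequence with $0<\theta_n<1$, and $\mu$ is the unique probability measure on $\mathscr{A}$ under which the $\zeta_n$ are independent with $\mu(\zeta_n=1)=\theta_n$, $\mu(\zeta_n=-1)=1-\theta_n$. Put $Z_n=\frac{\zeta_n+1-2\theta_n}{2\sqrt{\theta_n(1-\theta_n)}}$, $Z_\emptyset=1$ and $Z_\sigma=\prod_{i\in\sigma}Z_i$ for nonempty $\sigma\in\Gamma$. $\mathcal{L}^2=\mathcal{L}^2(\Sigma,\mathscr{A},\mu)$ is the complex Hilbert space with inner product $\langle\xi,\eta\rangle=\int_\Sigma\overline{\xi}\eta\,d\mu$; $\{Z_\sigma\mid\sigma\in\Gamma\}$ is an orthonormal basis of $\mathcal{L}^2$. Define $\lambda_\emptyset=1$ and $\lambda_\sigma=\prod_{k\in\sigma}(1+k)$ for nonempty $\sigma\in\Gamma$. For real $p\ge0$, $\mathcal{S}_p=\{\xi\in\mathcal{L}^2\mid \sum_{\sigma\in\Gamma}\lambda_\sigma^{2p}|\langle Z_\sigma,\xi\rangle|^2<\infty\}$, a Hilbert space with norm $\|\xi\|_p=\big(\sum_{\sigma\in\Gamma}\lambda_\sigma^{2p}|\langle Z_\sigma,\xi\rangle|^2\big)^{1/2}$.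 $\mathcal{S}=\bigcap_{p\ge0}\mathcal{S}_p$ carries the topology generated by the norms $\|\cdot\|_p$, $p\ge0$ (each $Z_\sigma\in\mathcal{S}$). $\mathcal{S}^*$ is the dual of $\mathcal{S}$ (continuous linear functionals) with the strong topology; its elements are called Bernoulli generalized functionals. The bilinear pairing on $\mathcal{S}^*\times\mathcal{S}$ is $\langle\!\langle\Phi,\xi\rangle\!\rangle=\Phi(\xi)$. $\mathfrak{L}(\mathcal{S},\mathcal{S}^* )$ is the space of continuous linear operators from $\mathcal{S}$ to $\mathcal{S}^*$. The 2D-Fock transform of $\mathsf{T}\colon\mathcal{S}\to\mathcal{S}^*$ is $\widehat{\mathsf{T}}(\sigma,\tau)=\langle\!\langle\mathsf{T}Z_\sigma,Z_\tau\rangle\!\rangle$, $\sigma,\tau\in\Gamma$. Known fact: elements of $\mathfrak{L}(\mathcal{S},\mathcal{S}^* )$ are determined by their 2D-Fock transforms, and a function $G$ on $\Gamma\times\Gamma$ is the 2D-Fock transform of some $\mathsf{T}\in\mathfrak{L}(\mathcal{S},\mathcal{S}^* )$ if and only if $|G(\sigma,\tau)|\le C\lambda_\sigma^p\lambda_\tau^p$ for all $\sigma,\tau\in\Gamma$, for some constants $C,p\ge0$. $\mathfrak{P}(\mathcal{L}^2)$ is the set of orthogonal projection operators on $\mathcal{L}^2$. A mapping $\pi\colon\mathscr{A}\to\mathfrak{P}(\mathcal{L}^2)$ is a spectral measure on $(\Sigma,\mathscr{A},\mu)$ if $\pi(\Sigma)=I$ and $\pi(\bigcup_{n\ge1}E_n)=\sum_{n\ge1}\pi(E_n)$,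 with convergence in the strong operator topology, for every sequence $(E_n)_{n\ge1}\subset\mathscr{A}$ of pairwise disjoint sets. It is $\mathcal{S}$-smooth if for each $(\sigma,\tau)\in\Gamma\times\Gamma$ there exists $\phi_{\sigma,\tau}^{\pi}\in\mathcal{S}$ (the numerical spectral density of $\pi$ associated with $(\sigma,\tau)$) such that $\langle\pi(E)Z_\sigma,Z_\tau\rangle=\int_E\phi_{\sigma,\tau}^{\pi}\,d\mu$ for all $E\in\mathscr{A}$. For an $\mathcal{S}$-smooth spectral measure $\pi$, $\Phi\in\mathcal{S}^*$ is integrable with respect to $\pi$ if there exist constants $C\ge0$, $p\ge0$ such that $|\langle\!\langle\Phi,\phi_{\sigma,\tau}^{\pi}\rangle\!\rangle|\le C\lambda_\sigma^p\lambda_\tau^p$ for all $(\sigma,\tau)\in\Gamma\times\Gamma$. In that case the spectral integral $\int_\Sigma\Phi\,d\pi$ is the unique operator in $\mathfrak{L}(\mathcal{S},\mathcal{S}^* )$ whose 2D-Fock transform is $(\sigma,\tau)\mapsto\langle\!\langle\Phi,\phi_{\sigma,\tau}^{\pi}\rangle\!\rangle$. A family $\{\Phi_\alpha\mid\alpha\in\Lambda\}\subset\mathcal{S}^*$ is uniformly integrable with respect to $\pi$ if there exist constants $C\ge0$, $p\ge0$ such that $\sup_{\alpha\in\Lambda}|\langle\!\langle\Phi_\alpha,\phi_{\sigma,\tau}^{\pi}\rangle\!\rangle|\le C\lambda_\sigma^p\lambda_\tau^p$ for all $(\sigma,\tau)\in\Gamma\times\Gamma$. *)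

theory Defs
  imports "HOL-Probability.Probability"
begin

text \<open>
  All notions depend on the sequence \<open>\<theta>\<close>, which is their first argument. Elements of
  \<open>L\<^sup>2\<close> are represented by square-integrable functions \<open>(nat \<Rightarrow> real) \<Rightarrow> complex\<close>; equality in
  \<open>L\<^sup>2\<close> is equality almost everywhere (\<open>aeq\<close>).
\<close>

definition bern_factor :: "real \<Rightarrow> real measure" where
  "bern_factor t = point_measure {-1, 1} (\<lambda>x. ennreal (if x = 1 then t else 1 - t))"

text \<open>The underlying set is \<open>{-1,1}\<close> to the power \<open>\<nat>\<close>, with the \<open>\<sigma>\<close>-field generated by the
  coordinates.\<close>

definition bern :: "(nat \<Rightarrow> real) \<Rightarrow> (nat \<Rightarrow> real) measure" where
  "bern \<theta> = PiM UNIV (\<lambda>n. bern_factor (\<theta> n))"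

definition fin_subsets :: "nat set set" where
  "fin_subsets = {\<sigma>. finite \<sigma>}"

definition Z1 :: "(nat \<Rightarrow> real) \<Rightarrow> nat \<Rightarrow> (nat \<Rightarrow> real) \<Rightarrow> real" where
  "Z1 \<theta> n \<omega> = (\<omega> n + 1 - 2 * \<theta> n) / (2 * sqrt (\<theta> n * (1 - \<theta> n)))"

definition Z :: "(nat \<Rightarrow> real) \<Rightarrow> nat set \<Rightarrow> (nat \<Rightarrow> real) \<Rightarrow> complex" where
  "Z \<theta> \<sigma> \<omega> = complex_of_real (\<Prod>i\<in>\<sigma>. Z1 \<theta> i \<omega>)"

definition aeq :: "(nat \<Rightarrow> real) \<Rightarrow> ((nat \<Rightarrow> real) \<Rightarrow> complex) \<Rightarrow> ((nat \<Rightarrow> real) \<Rightarrow> complex) \<Rightarrow> bool" where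
  "aeq \<theta> \<xi> \<eta> \<longleftrightarrow> (AE \<omega> in bern \<theta>. \<xi> \<omega> = \<eta> \<omega>)"

definition L2 :: "(nat \<Rightarrow> real) \<Rightarrow> ((nat \<Rightarrow> real) \<Rightarrow> complex) set" where
  "L2 \<theta> = {\<xi> \<in> borel_measurable (bern \<theta>). integrable (bern \<theta>) (\<lambda>\<omega>. (cmod (\<xi> \<omega>))\<^sup>2)}"

definition L2_inner ::
    "(nat \<Rightarrow> real) \<Rightarrow> ((nat \<Rightarrow> real) \<Rightarrow> complex) \<Rightarrow> ((nat \<Rightarrow> real) \<Rightarrow> complex) \<Rightarrow> complex" where
  "L2_inner \<theta> \<xi> \<eta> = (LINT \<omega>|bern \<theta>. cnj (\<xi> \<omega>) * \<eta> \<omega>)"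

definition L2_norm :: "(nat \<Rightarrow> real) \<Rightarrow> ((nat \<Rightarrow> real) \<Rightarrow> complex) \<Rightarrow> real" where
  "L2_norm \<theta> \<xi> = sqrt (LINT \<omega>|bern \<theta>. (cmod (\<xi> \<omega>))\<^sup>2)"

definition lam :: "nat set \<Rightarrow> real" where
  "lam \<sigma> = (\<Prod>k\<in>\<sigma>. 1 + real k)"

definition Sp :: "(nat \<Rightarrow> real) \<Rightarrow> real \<Rightarrow> ((nat \<Rightarrow> real) \<Rightarrow> complex) set" where
  "Sp \<theta> p = {\<xi> \<in> L2 \<theta>.
     (\<lambda>\<sigma>. lam \<sigma> powr (2 * p) * (cmod (L2_inner \<theta> (Z \<theta> \<sigma>) \<xi>))\<^sup>2) summable_on fin_subsets}"

definition Sp_norm :: "(nat \<Rightarrow> real) \<Rightarrow> real \<Rightarrow> ((nat \<Rightarrow> real) \<Rightarrow> complex) \<Rightarrow> real" where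
  "Sp_norm \<theta> p \<xi> =
     sqrt (\<Sum>\<^sub>\<infinity>\<sigma>\<in>fin_subsets. lam \<sigma> powr (2 * p) * (cmod (L2_inner \<theta> (Z \<theta> \<sigma>) \<xi>))\<^sup>2)"

definition S :: "(nat \<Rightarrow> real) \<Rightarrow> ((nat \<Rightarrow> real) \<Rightarrow> complex) set" where
  "S \<theta> = (\<Inter>p\<in>{0..}. Sp \<theta> p)"

definition S_top :: "(nat \<Rightarrow> real) \<Rightarrow> ((nat \<Rightarrow> real) \<Rightarrow> complex) topology" where
  "S_top \<theta> = topology_generated_by
     {{\<eta> \<in> S \<theta>. Sp_norm \<theta> p (\<lambda>\<omega>. \<eta> \<omega> - \<xi> \<omega>) < r} | \<xi> p r. \<xi> \<in> S \<theta> \<and> 0 \<le> p \<and> 0 < r}"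

text \<open>Boundedness in the sense of topological vector spaces: every open neighbourhood \<open>U\<close> of \<open>0\<close>
  absorbs \<open>B\<close>, that is, \<open>B \<subseteq> t U\<close> for all large real \<open>t\<close>.\<close>

definition S_bounded :: "(nat \<Rightarrow> real) \<Rightarrow> ((nat \<Rightarrow> real) \<Rightarrow> complex) set \<Rightarrow> bool" where
  "S_bounded \<theta> B \<longleftrightarrow> B \<subseteq> S \<theta> \<and>
     (\<forall>U. openin (S_top \<theta>) U \<and> (\<lambda>_. 0) \<in> U \<longrightarrow>
        (\<exists>s>0. \<forall>t>s. B \<subseteq> (\<lambda>\<xi> \<omega>. complex_of_real t * \<xi> \<omega>) ` U))"

text \<open>Functionals on \<open>S\<close> are extensional (equal to \<open>undefined\<close> outside \<open>S\<close>), so that equality of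
  generalized functionals is equality in HOL. By continuity they do not distinguish elements of \<open>S\<close>
  that are equal almost everywhere.\<close>

definition Sdual :: "(nat \<Rightarrow> real) \<Rightarrow> (((nat \<Rightarrow> real) \<Rightarrow> complex) \<Rightarrow> complex) set" where
  "Sdual \<theta> = {\<Phi> \<in> extensional (S \<theta>).
     (\<forall>\<xi>\<in>S \<theta>. \<forall>\<eta>\<in>S \<theta>. \<Phi> (\<lambda>\<omega>. \<xi> \<omega> + \<eta> \<omega>) = \<Phi> \<xi> + \<Phi> \<eta>) \<and>
     (\<forall>c. \<forall>\<xi>\<in>S \<theta>. \<Phi> (\<lambda>\<omega>. c * \<xi> \<omega>) = c * \<Phi> \<xi>) \<and>
     continuous_map (S_top \<theta>) euclidean \<Phi>}"

text \<open>The strong topology: uniform convergence on bounded subsets of \<open>S\<close>.\<close>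

definition strong_top :: "(nat \<Rightarrow> real) \<Rightarrow> (((nat \<Rightarrow> real) \<Rightarrow> complex) \<Rightarrow> complex) topology" where
  "strong_top \<theta> = topology_generated_by
     {{\<Psi> \<in> Sdual \<theta>. (SUP \<xi>\<in>B. cmod (\<Psi> \<xi> - \<Phi> \<xi>)) < r} | \<Phi> B r.
        \<Phi> \<in> Sdual \<theta> \<and> S_bounded \<theta> B \<and> B \<noteq> {} \<and> 0 < r}"

definition SSdual_ops ::
    "(nat \<Rightarrow> real) \<Rightarrow> (((nat \<Rightarrow> real) \<Rightarrow> complex) \<Rightarrow> ((nat \<Rightarrow> real) \<Rightarrow> complex) \<Rightarrow> complex) set" where
  "SSdual_ops \<theta> = {T \<in> extensional (S \<theta>).
     (\<forall>\<xi>\<in>S \<theta>. T \<xi> \<in> Sdual \<theta>) \<and>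
     (\<forall>\<xi>\<in>S \<theta>. \<forall>\<eta>\<in>S \<theta>. \<forall>\<zeta>\<in>S \<theta>. T (\<lambda>\<omega>. \<xi> \<omega> + \<eta> \<omega>) \<zeta> = T \<xi> \<zeta> + T \<eta> \<zeta>) \<and>
     (\<forall>c. \<forall>\<xi>\<in>S \<theta>. \<forall>\<zeta>\<in>S \<theta>. T (\<lambda>\<omega>. c * \<xi> \<omega>) \<zeta> = c * T \<xi> \<zeta>) \<and>
     continuous_map (S_top \<theta>) (strong_top \<theta>) T}"

definition fock2 ::
    "(nat \<Rightarrow> real) \<Rightarrow> (((nat \<Rightarrow> real) \<Rightarrow> complex) \<Rightarrow> ((nat \<Rightarrow> real) \<Rightarrow> complex) \<Rightarrow> complex) \<Rightarrow>
     nat set \<Rightarrow> nat set \<Rightarrow> complex" where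
  "fock2 \<theta> T \<sigma> \<tau> = T (Z \<theta> \<sigma>) (Z \<theta> \<tau>)"

text \<open>Operators act on representatives; being linear and bounded, they respect equality almost
  everywhere.\<close>

definition L2_bounded_op ::
    "(nat \<Rightarrow> real) \<Rightarrow> (((nat \<Rightarrow> real) \<Rightarrow> complex) \<Rightarrow> (nat \<Rightarrow> real) \<Rightarrow> complex) \<Rightarrow> bool" where
  "L2_bounded_op \<theta> P \<longleftrightarrow>
     (\<forall>\<xi>\<in>L2 \<theta>. P \<xi> \<in> L2 \<theta>) \<and>
     (\<forall>\<xi>\<in>L2 \<theta>. \<forall>\<eta>\<in>L2 \<theta>. aeq \<theta> (P (\<lambda>\<omega>. \<xi> \<omega> + \<eta> \<omega>)) (\<lambda>\<omega>. P \<xi> \<omega> + P \<eta> \<omega>)) \<and>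
     (\<forall>c. \<forall>\<xi>\<in>L2 \<theta>. aeq \<theta> (P (\<lambda>\<omega>. c * \<xi> \<omega>)) (\<lambda>\<omega>. c * P \<xi> \<omega>)) \<and>
     (\<exists>K. \<forall>\<xi>\<in>L2 \<theta>. L2_norm \<theta> (P \<xi>) \<le> K * L2_norm \<theta> \<xi>)"

definition L2_projections ::
    "(nat \<Rightarrow> real) \<Rightarrow> (((nat \<Rightarrow> real) \<Rightarrow> complex) \<Rightarrow> (nat \<Rightarrow> real) \<Rightarrow> complex) set" where
  "L2_projections \<theta> = {P. L2_bounded_op \<theta> P \<and>
     (\<forall>\<xi>\<in>L2 \<theta>. aeq \<theta> (P (P \<xi>)) (P \<xi>)) \<and>
     (\<forall>\<xi>\<in>L2 \<theta>. \<forall>\<eta>\<in>L2 \<theta>. L2_inner \<theta> (P \<xi>) \<eta> = L2_inner \<theta> \<xi> (P \<eta>))}"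

definition spectral_measure ::
    "(nat \<Rightarrow> real) \<Rightarrow>
     ((nat \<Rightarrow> real) set \<Rightarrow> ((nat \<Rightarrow> real) \<Rightarrow> complex) \<Rightarrow> (nat \<Rightarrow> real) \<Rightarrow> complex) \<Rightarrow> bool" where
  "spectral_measure \<theta> \<pi> \<longleftrightarrow>
     (\<forall>E\<in>sets (bern \<theta>). \<pi> E \<in> L2_projections \<theta>) \<and>
     (\<forall>\<xi>\<in>L2 \<theta>. aeq \<theta> (\<pi> (space (bern \<theta>)) \<xi>) \<xi>) \<and>
     (\<forall>E::nat \<Rightarrow> (nat \<Rightarrow> real) set. range E \<subseteq> sets (bern \<theta>) \<and> disjoint_family E \<longrightarrow>
        (\<forall>\<xi>\<in>L2 \<theta>. (\<lambda>N. L2_norm \<theta> (\<lambda>\<omega>. (\<Sum>n<N. \<pi> (E n) \<xi> \<omega>) - \<pi> (\<Union>n. E n) \<xi> \<omega>)) \<longlonglongrightarrow> 0))"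

definition is_spectral_density ::
    "(nat \<Rightarrow> real) \<Rightarrow>
     ((nat \<Rightarrow> real) set \<Rightarrow> ((nat \<Rightarrow> real) \<Rightarrow> complex) \<Rightarrow> (nat \<Rightarrow> real) \<Rightarrow> complex) \<Rightarrow>
     nat set \<Rightarrow> nat set \<Rightarrow> ((nat \<Rightarrow> real) \<Rightarrow> complex) \<Rightarrow> bool" where
  "is_spectral_density \<theta> \<pi> \<sigma> \<tau> \<phi> \<longleftrightarrow> \<phi> \<in> S \<theta> \<and>
     (\<forall>E\<in>sets (bern \<theta>). L2_inner \<theta> (\<pi> E (Z \<theta> \<sigma>)) (Z \<theta> \<tau>) = (LINT \<omega>:E|bern \<theta>. \<phi> \<omega>))"

definition S_smooth ::
    "(nat \<Rightarrow> real) \<Rightarrow>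
     ((nat \<Rightarrow> real) set \<Rightarrow> ((nat \<Rightarrow> real) \<Rightarrow> complex) \<Rightarrow> (nat \<Rightarrow> real) \<Rightarrow> complex) \<Rightarrow> bool" where
  "S_smooth \<theta> \<pi> \<longleftrightarrow>
     (\<forall>\<sigma>\<in>fin_subsets. \<forall>\<tau>\<in>fin_subsets. \<exists>\<phi>. is_spectral_density \<theta> \<pi> \<sigma> \<tau> \<phi>)"

text \<open>The density is unique up to equality almost everywhere, so the value of a generalized
  functional at it does not depend on the choice.\<close>

definition spectral_density ::
    "(nat \<Rightarrow> real) \<Rightarrow>
     ((nat \<Rightarrow> real) set \<Rightarrow> ((nat \<Rightarrow> real) \<Rightarrow> complex) \<Rightarrow> (nat \<Rightarrow> real) \<Rightarrow> complex) \<Rightarrow>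
     nat set \<Rightarrow> nat set \<Rightarrow> (nat \<Rightarrow> real) \<Rightarrow> complex" where
  "spectral_density \<theta> \<pi> \<sigma> \<tau> = (SOME \<phi>. is_spectral_density \<theta> \<pi> \<sigma> \<tau> \<phi>)"

definition spectral_integrable ::
    "(nat \<Rightarrow> real) \<Rightarrow>
     ((nat \<Rightarrow> real) set \<Rightarrow> ((nat \<Rightarrow> real) \<Rightarrow> complex) \<Rightarrow> (nat \<Rightarrow> real) \<Rightarrow> complex) \<Rightarrow>
     (((nat \<Rightarrow> real) \<Rightarrow> complex) \<Rightarrow> complex) \<Rightarrow> bool" where
  "spectral_integrable \<theta> \<pi> \<Phi> \<longleftrightarrow>
     (\<exists>C\<ge>0. \<exists>p\<ge>0. \<forall>\<sigma>\<in>fin_subsets. \<forall>\<tau>\<in>fin_subsets.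
        cmod (\<Phi> (spectral_density \<theta> \<pi> \<sigma> \<tau>)) \<le> C * lam \<sigma> powr p * lam \<tau> powr p)"

definition spectral_uniformly_integrable ::
    "(nat \<Rightarrow> real) \<Rightarrow>
     ((nat \<Rightarrow> real) set \<Rightarrow> ((nat \<Rightarrow> real) \<Rightarrow> complex) \<Rightarrow> (nat \<Rightarrow> real) \<Rightarrow> complex) \<Rightarrow>
     ('i \<Rightarrow> ((nat \<Rightarrow> real) \<Rightarrow> complex) \<Rightarrow> complex) \<Rightarrow> 'i set \<Rightarrow> bool" where
  "spectral_uniformly_integrable \<theta> \<pi> \<Phi> I \<longleftrightarrow>
     (\<exists>C\<ge>0. \<exists>p\<ge>0. \<forall>\<sigma>\<in>fin_subsets. \<forall>\<tau>\<in>fin_subsets. \<forall>\<alpha>\<in>I.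
        cmod (\<Phi> \<alpha> (spectral_density \<theta> \<pi> \<sigma> \<tau>)) \<le> C * lam \<sigma> powr p * lam \<tau> powr p)"

definition spectral_integral ::
    "(nat \<Rightarrow> real) \<Rightarrow>
     ((nat \<Rightarrow> real) set \<Rightarrow> ((nat \<Rightarrow> real) \<Rightarrow> complex) \<Rightarrow> (nat \<Rightarrow> real) \<Rightarrow> complex) \<Rightarrow>
     (((nat \<Rightarrow> real) \<Rightarrow> complex) \<Rightarrow> complex) \<Rightarrow>
     ((nat \<Rightarrow> real) \<Rightarrow> complex) \<Rightarrow> ((nat \<Rightarrow> real) \<Rightarrow> complex) \<Rightarrow> complex" where
  "spectral_integral \<theta> \<pi> \<Phi> = (THE T. T \<in> SSdual_ops \<theta> \<and>
     (\<forall>\<sigma>\<in>fin_subsets. \<forall>\<tau>\<in>fin_subsets. fock2 \<theta> T \<sigma> \<tau> = \<Phi> (spectral_density \<theta> \<pi> \<sigma> \<tau>)))"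

lemma space_bern: "space (bern \<theta>) = {\<omega>. \<forall>n. \<omega> n \<in> {-1, 1}}"
  by (auto simp: bern_def bern_factor_def space_PiM space_point_measure PiE_def Pi_def)

lemma prob_space_bern_factor:
  assumes "0 < t" "t < 1"
  shows "prob_space (bern_factor t)"
proof
  have "emeasure (bern_factor t) {-1, 1} = ennreal (1 - t) + ennreal t"
    unfolding bern_factor_def by (subst emeasure_point_measure_finite) auto
  also have "\<dots> = 1"
    using assms by (simp flip: ennreal_plus)
  finally show "emeasure (bern_factor t) (space (bern_factor t)) = 1"
    by (simp add: bern_factor_def space_point_measure)
qed

lemma prob_space_bern:
  assumes "\<And>n. 0 < \<theta> n \<and> \<theta> n < 1"
  shows "prob_space (bern \<theta>)"
  unfolding bern_def using assms by (intro prob_space_PiM prob_space_bern_factor) auto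

lemma bern_marginal:
  assumes "\<And>n. 0 < \<theta> n \<and> \<theta> n < 1"
  shows "distr (bern \<theta>) (bern_factor (\<theta> n)) (\<lambda>\<omega>. \<omega> n) = bern_factor (\<theta> n)"
  unfolding bern_def
  using assms by (intro distr_PiM_component prob_space_bern_factor) auto

lemma measure_bern_factor:
  assumes "0 < t" "t < 1"
  shows "measure (bern_factor t) {1} = t" "measure (bern_factor t) {-1} = 1 - t"
  using assms
  by (auto simp: bern_factor_def measure_def emeasure_point_measure_finite)

lemma bern_indep:
  assumes "\<And>n. 0 < \<theta> n \<and> \<theta> n < 1"
  shows "prob_space.indep_vars (bern \<theta>) (\<lambda>n. bern_factor (\<theta> n)) (\<lambda>n \<omega>. \<omega> n) UNIV"
proof -
  interpret prob_space "bern \<theta>" by (rule prob_space_bern) (rule assms)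
  have "distr (bern \<theta>) (PiM UNIV (\<lambda>n. bern_factor (\<theta> n))) (\<lambda>\<omega>. \<lambda>n\<in>UNIV. \<omega> n) = bern \<theta>"
    by (simp add: restrict_UNIV bern_def distr_id)
  also have "\<dots> = PiM UNIV (\<lambda>n. distr (bern \<theta>) (bern_factor (\<theta> n)) (\<lambda>\<omega>. \<omega> n))"
    unfolding bern_marginal[where \<theta> = \<theta>, OF assms] by (simp add: bern_def)
  finally show ?thesis
    by (subst indep_vars_iff_distr_eq_PiM') (auto simp: bern_def)
qed

end

theory Submission
  imports Defs
begin

text \<open>
  The norms \<open>Sp_norm\<close> depend on \<open>\<xi>\<close> only through its coefficients \<open>cf \<xi> \<sigma>\<close>, which decay faster than any
  power of \<open>lam \<sigma>\<close>, and \<open>lam\<close> to the power \<open>-2\<close> is summable. Hence a kernel \<open>G\<close> of growth \<open>p\<close> defines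
  the operator \<open>\<xi> \<mapsto> \<eta> \<mapsto> \<Sum>\<sigma> \<tau>. cf \<xi> \<sigma> * cf \<eta> \<tau> * G \<sigma> \<tau>\<close>, which is bounded by the product of the \<open>q\<close>-norms of
  \<open>\<xi>\<close> and \<open>\<eta>\<close>, for \<open>q = p + 2\<close>, times a weighted \<open>\<ell>\<^sup>1\<close> norm of \<open>G\<close>. Continuous functionals are determined by
  their values on the orthonormal system \<open>Z\<close>, so every spectral integral is such an operator. Under uniform
  integrability the kernels converge in the weighted \<open>\<ell>\<^sup>1\<close> norm by dominated convergence, and since
  bounded sets are bounded in the \<open>q\<close>-norm this is strong convergence.
\<close>

section \<open>Limits and differences of unordered sums\<close>

text \<open>Dominated convergence for counting measure. A finite set \<open>F\<close> carries all
  but \<open>e / 2\<close> of the mass of \<open>g\<close>: outside \<open>F\<close> the majorant is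
  used, on \<open>F\<close> the finitely many pointwise limits. The majorant is required only
  eventually because the sequences to which this is applied are controlled from index 1 on.\<close>

lemma infsum_tendsto_0_dominated:
  fixes f :: "nat \<Rightarrow> 'a \<Rightarrow> real"
  assumes lim: "\<And>x. x \<in> A \<Longrightarrow> (\<lambda>n. f n x) \<longlonglongrightarrow> 0"
    and bound: "\<forall>\<^sub>F n in sequentially. \<forall>x\<in>A. \<bar>f n x\<bar> \<le> g x"
    and g: "g summable_on A"
  shows "(\<lambda>n. infsum (f n) A) \<longlonglongrightarrow> 0"
proof (rule tendstoI)
  fix e :: real assume "0 < e"
  then have "0 < e / 2" by simp
  from infsum_finite_approximation[OF g this] obtain F where
    F: "finite F" "F \<subseteq> A" "dist (sum g F) (infsum g A) \<le> e / 2" by blast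
  have "(\<lambda>n. \<Sum>x\<in>F. \<bar>f n x\<bar>) \<longlonglongrightarrow> (\<Sum>x\<in>F. \<bar>0\<bar>)"
    using F lim by (intro tendsto_sum tendsto_rabs) auto
  then have "\<forall>\<^sub>F n in sequentially. (\<Sum>x\<in>F. \<bar>f n x\<bar>) < e / 2"
    using \<open>0 < e / 2\<close> by (intro order_tendstoD(2)) auto
  with bound show "\<forall>\<^sub>F n in sequentially. dist (infsum (f n) A) 0 < e"
  proof eventually_elim
    case (elim n)
    have abs: "(\<lambda>x. \<bar>f n x\<bar>) summable_on A"
      using elim by (intro summable_on_comparison_test[OF g]) auto
    have tail: "infsum (\<lambda>x. \<bar>f n x\<bar>) (A - F) \<le> infsum g (A - F)"
      using elim by (intro infsum_mono summable_on_subset_banach[OF abs] summable_on_subset_banach[OF g]) auto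
    have "\<bar>infsum (f n) A\<bar> \<le> infsum (\<lambda>x. \<bar>f n x\<bar>) A"
      using norm_infsum_bound[of "f n" A] abs by simp
    also have "\<dots> = infsum (\<lambda>x. \<bar>f n x\<bar>) (A - F) + (\<Sum>x\<in>F. \<bar>f n x\<bar>)"
      using infsum_Diff[OF abs _ F(2)] F by simp
    also have "\<dots> < e / 2 + e / 2"
    proof (rule add_le_less_mono)
      have "infsum g (A - F) \<le> e / 2"
        using infsum_Diff[OF g _ F(2)] F abs_ge_minus_self[of "sum g F - infsum g A"]
        unfolding dist_real_def by simp
      with tail show "infsum (\<lambda>x. \<bar>f n x\<bar>) (A - F) \<le> e / 2" by simp
      show "(\<Sum>x\<in>F. \<bar>f n x\<bar>) < e / 2" using elim by simp
    qed
    finally show ?case by simp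
  qed
qed

lemma infsum_diff:
  fixes f g :: "'a \<Rightarrow> 'b :: real_normed_vector"
  assumes "f summable_on A" "g summable_on A"
  shows "infsum (\<lambda>x. f x - g x) A = infsum f A - infsum g A"
  using infsum_add[of f A "\<lambda>x. - g x"] assms by (simp add: infsum_uminus summable_on_uminus)

section \<open>Summability of the weights \<open>lam\<close>\<close>

lemma lam_ge_1: "1 \<le> lam \<sigma>"
  unfolding lam_def by (rule prod_ge_1) auto

lemma lam_pos: "0 < lam \<sigma>"
  using lam_ge_1[of \<sigma>] by linarith

text \<open>The partial sums are bounded by the Euler product \<open>\<Prod>k. 1 + (1 + k)\<^sup>-\<^sup>2\<close>.\<close>

lemma summable_lam_powr: "(\<lambda>\<sigma>. lam \<sigma> powr -2) summable_on fin_subsets"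
proof (rule nonneg_bdd_above_summable_on)
  let ?s = "\<lambda>k. inverse ((1 + real k)\<^sup>2)"
  have s: "summable ?s"
    \<comment> \<open>This is the series of inverse squares shifted by one; its dropped term at 0 is
      the default value \<open>inverse 0 = 0\<close>.\<close>
    using inverse_power_summable[of 2, where ?'a = real] summable_Suc_iff[of "\<lambda>k. inverse ((real k)\<^sup>2)"]
    by (simp add: add.commute)
  show "bdd_above (sum (\<lambda>\<sigma>. lam \<sigma> powr - 2) ` {F. F \<subseteq> fin_subsets \<and> finite F})"
  proof (rule bdd_aboveI2)
    fix F assume "F \<in> {F. F \<subseteq> fin_subsets \<and> finite F}"
    then have F: "finite (\<Union>F)" "finite F" by (auto simp: fin_subsets_def)
    have "(\<Sum>\<sigma>\<in>F. lam \<sigma> powr - 2) \<le> (\<Sum>\<sigma>\<in>Pow (\<Union>F). lam \<sigma> powr - 2)"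
      using F by (intro sum_mono2) auto
    also have "\<dots> = (\<Sum>\<sigma>\<in>Pow (\<Union>F). (\<Prod>k\<in>\<sigma>. ?s k) * (\<Prod>k\<in>\<Union>F - \<sigma>. 1))"
    proof (rule sum.cong[OF refl])
      fix \<sigma> :: "nat set"
      have "lam \<sigma> powr -2 = inverse ((lam \<sigma>)\<^sup>2)"
        using lam_pos[of \<sigma>] by (simp add: powr_minus powr_numeral)
      then show "lam \<sigma> powr - 2 = (\<Prod>k\<in>\<sigma>. ?s k) * (\<Prod>k\<in>\<Union>F - \<sigma>. 1)"
        by (simp add: lam_def prod_power_distrib o_def flip: prod_inversef)
    qed
    also have "\<dots> = (\<Prod>k\<in>\<Union>F. ?s k + 1)"
      using F by (simp add: prod_add)
    also have "\<dots> \<le> exp (\<Sum>k\<in>\<Union>F. ?s k)"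
      using prod_le_exp_sum[of "\<Union>F" ?s] by (simp add: add.commute)
    also have "\<dots> \<le> exp (suminf ?s)"
      using F s by (auto intro: sum_le_suminf)
    finally show "(\<Sum>\<sigma>\<in>F. lam \<sigma> powr - 2) \<le> exp (suminf ?s)" .
  qed
qed auto

text \<open>The terms are nonnegative, so summing over one variable at a time suffices. This is the
  common majorant of all kernels once weights of order \<open>p + 2\<close> have absorbed a growth
  of order \<open>p\<close>.\<close>

lemma summable_lam_powr_pairs:
  "(\<lambda>(\<sigma>, \<tau>). lam \<sigma> powr -2 * lam \<tau> powr -2) summable_on fin_subsets \<times> fin_subsets"
proof (rule summable_on_SigmaI)
  fix \<sigma>
  show "((\<lambda>\<tau>. case (\<sigma>, \<tau>) of (\<sigma>, \<tau>) \<Rightarrow> lam \<sigma> powr -2 * lam \<tau> powr -2) has_sum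
      lam \<sigma> powr -2 * infsum (\<lambda>\<tau>. lam \<tau> powr -2) fin_subsets) fin_subsets"
    using has_sum_cmult_right[OF has_sum_infsum[OF summable_lam_powr]] by simp
qed (auto intro!: summable_on_cmult_left summable_lam_powr)

section \<open>Integration on the Bernoulli space and orthonormality of the system
  \<open>Z\<close>\<close>

lemma integral_bern_factor:
  assumes "0 < t" "t < 1"
  shows "(LINT x|bern_factor t. g x) = (1 - t) * g (-1) + t * (g (1::real) :: real)"
  using assms unfolding bern_factor_def
  by (subst lebesgue_integral_point_measure_finite) auto

locale bernoulli_space =
  fixes \<theta> :: "nat \<Rightarrow> real"
  assumes theta_bounds: "0 < \<theta> n \<and> \<theta> n < 1"
begin

text \<open>The one-coordinate space carries the full power set as its sigma-field.\<close>

lemma measurable_bern_factor: "g \<in> borel_measurable (bern_factor t)"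
  by (simp add: bern_factor_def measurable_def sets_point_measure space_point_measure)

lemma measurable_coordinate: "(\<lambda>\<omega>. \<omega> n) \<in> measurable (bern \<theta>) (bern_factor (\<theta> n))"
  unfolding bern_def by measurable

lemma measurable_fun_coordinate: "(\<lambda>\<omega>. g (\<omega> n)) \<in> borel_measurable (bern \<theta>)"
  using measurable_compose[OF measurable_coordinate measurable_bern_factor] .

lemma integral_fun_coordinate:
  "(LINT \<omega>|bern \<theta>. g (\<omega> n)) = (1 - \<theta> n) * g (-1) + \<theta> n * (g (1::real) :: real)"
  using theta_bounds[of n] integral_bern_factor[of "\<theta> n" g]
    integral_distr[OF measurable_coordinate measurable_bern_factor, of n g]
    bern_marginal[of \<theta> n, OF theta_bounds] by simp

lemma Z_measurable: "Z \<theta> \<sigma> \<in> borel_measurable (bern \<theta>)"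
proof -
  have [measurable]: "(\<lambda>\<omega>. Z1 \<theta> i \<omega>) \<in> borel_measurable (bern \<theta>)" for i
    unfolding Z1_def by (rule measurable_fun_coordinate)
  show ?thesis unfolding Z_def[abs_def] by measurable
qed

lemma integrable_bern_bounded:
  fixes f :: "_ \<Rightarrow> 'a :: {banach, second_countable_topology}"
  assumes "f \<in> borel_measurable (bern \<theta>)" "\<And>\<omega>. \<omega> \<in> space (bern \<theta>) \<Longrightarrow> norm (f \<omega>) \<le> B"
  shows "integrable (bern \<theta>) f"
proof -
  interpret prob_space "bern \<theta>" by (rule prob_space_bern) (rule theta_bounds)
  show ?thesis using assms by (intro integrable_const_bound[of _ B]) auto
qed

text \<open>A coordinate takes only the values -1 and 1, so the left side is one of the two
  summands. The crude bound serves boundedness and integrability.\<close>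

lemma coordinate_bound:
  assumes "\<omega> \<in> space (bern \<theta>)"
  shows "\<bar>g (\<omega> n) :: real\<bar> \<le> \<bar>g (-1)\<bar> + \<bar>g (1::real)\<bar>"
proof -
  have "\<omega> n = -1 \<or> \<omega> n = 1" using assms by (auto simp: space_bern)
  then show ?thesis by auto
qed

lemma Z_bounded: "\<exists>B. \<forall>\<omega>\<in>space (bern \<theta>). cmod (Z \<theta> \<sigma> \<omega>) \<le> B"
proof -
  let ?g = "\<lambda>i x. (x + 1 - 2 * \<theta> i) / (2 * sqrt (\<theta> i * (1 - \<theta> i)))"
  have "cmod (Z \<theta> \<sigma> \<omega>) \<le> (\<Prod>i\<in>\<sigma>. \<bar>?g i (-1)\<bar> + \<bar>?g i 1\<bar>)" if "\<omega> \<in> space (bern \<theta>)" for \<omega>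
    unfolding Z_def Z1_def norm_of_real abs_prod
    using coordinate_bound[OF that] by (intro prod_mono conjI abs_ge_zero)
  then show ?thesis by blast
qed

lemma integral_Z1: "(LINT \<omega>|bern \<theta>. Z1 \<theta> n \<omega>) = 0"
  unfolding Z1_def by (subst integral_fun_coordinate) (auto simp: divide_simps algebra_simps)

lemma integral_Z1_square: "(LINT \<omega>|bern \<theta>. (Z1 \<theta> n \<omega>)\<^sup>2) = 1"
proof -
  \<comment> \<open>Nonnegativity lets the square of the root cancel, and the factor being nonzero
    allows dividing by it.\<close>
  have "\<theta> n * (1 - \<theta> n) \<noteq> 0" "\<theta> n * (1 - \<theta> n) \<ge> 0" using theta_bounds[of n] by auto
  then show ?thesis
    unfolding Z1_def
    apply (subst integral_fun_coordinate)
    apply (simp add: power_divide power_mult_distrib)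
    apply (simp add: divide_simps)
    apply (simp add: power2_eq_square algebra_simps)
    done
qed

text \<open>The product of the two functions is a product of functions of single coordinates over
  \<open>\<sigma> \<union> \<tau>\<close>, so its integral factorises by independence. An index in
  both sets contributes the second moment 1 of \<open>Z1\<close>, an index in exactly one set the
  mean 0.\<close>

lemma Z_orthonormal:
  assumes "\<sigma> \<in> fin_subsets" "\<tau> \<in> fin_subsets"
  shows "L2_inner \<theta> (Z \<theta> \<sigma>) (Z \<theta> \<tau>) = (if \<sigma> = \<tau> then 1 else 0)"
proof -
  interpret prob_space "bern \<theta>" by (rule prob_space_bern) (rule theta_bounds)
  have fin: "finite \<sigma>" "finite \<tau>" using assms by (auto simp: fin_subsets_def)
  \<comment> \<open>The factor at coordinate \<open>i\<close>, with default 1 where an index is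
    absent. It is a function of one real variable so that independence of the coordinates applies to
    \<open>h i (\<omega> i)\<close>.\<close>
  define h where "h i x = (if i \<in> \<sigma> then (x + 1 - 2 * \<theta> i) / (2 * sqrt (\<theta> i * (1 - \<theta> i))) else 1) *
     (if i \<in> \<tau> then (x + 1 - 2 * \<theta> i) / (2 * sqrt (\<theta> i * (1 - \<theta> i))) else 1)" for i x
  have h: "h i (\<omega> i) = (if i \<in> \<sigma> then Z1 \<theta> i \<omega> else 1) * (if i \<in> \<tau> then Z1 \<theta> i \<omega> else 1)" for i \<omega>
    by (simp add: h_def Z1_def)
  have "(\<Prod>i\<in>\<sigma>. Z1 \<theta> i \<omega>) * (\<Prod>i\<in>\<tau>. Z1 \<theta> i \<omega>) = (\<Prod>i\<in>\<sigma> \<union> \<tau>. h i (\<omega> i))" for \<omega>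
    unfolding h prod.distrib using fin by (simp add: prod.If_cases Int_absorb1 Int_absorb2)
  then have "L2_inner \<theta> (Z \<theta> \<sigma>) (Z \<theta> \<tau>) = (LINT \<omega>|bern \<theta>. complex_of_real (\<Prod>i\<in>\<sigma> \<union> \<tau>. h i (\<omega> i)))"
    unfolding L2_inner_def Z_def by (simp del: of_real_prod flip: of_real_mult)
  also have "\<dots> = complex_of_real (LINT \<omega>|bern \<theta>. (\<Prod>i\<in>\<sigma> \<union> \<tau>. h i (\<omega> i)))"
    by (rule integral_complex_of_real)
  also have "(LINT \<omega>|bern \<theta>. (\<Prod>i\<in>\<sigma> \<union> \<tau>. h i (\<omega> i))) = (\<Prod>i\<in>\<sigma> \<union> \<tau>. LINT \<omega>|bern \<theta>. h i (\<omega> i))"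
  proof (rule indep_vars_lebesgue_integral)
    show "indep_vars (\<lambda>_. borel) (\<lambda>i \<omega>. h i (\<omega> i)) (\<sigma> \<union> \<tau>)"
      using indep_vars_subset[OF indep_vars_compose2[OF bern_indep[of \<theta>, OF theta_bounds] measurable_bern_factor]]
      by blast
    show "integrable (bern \<theta>) (\<lambda>\<omega>. h i (\<omega> i))" for i
      using integrable_bern_bounded[OF measurable_fun_coordinate[of "h i"]] coordinate_bound[of _ "h i"]
      by (metis real_norm_def)
  qed (use fin in auto)
  also have "\<dots> = (\<Prod>i\<in>\<sigma> \<union> \<tau>. if i \<in> \<sigma> \<inter> \<tau> then 1 else 0)"
    unfolding h by (intro prod.cong) (auto simp: integral_Z1 integral_Z1_square simp flip: power2_eq_square)
  also have "\<dots> = (if \<sigma> = \<tau> then 1 else 0)"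
    using fin by (auto simp: prod_zero_iff intro!: prod.neutral)
  finally show ?thesis by simp
qed

subsection \<open>Coefficients and the topology of test functions\<close>

lemma L2_add:
  assumes "\<xi> \<in> L2 \<theta>" "\<eta> \<in> L2 \<theta>"
  shows "(\<lambda>\<omega>. \<xi> \<omega> + \<eta> \<omega>) \<in> L2 \<theta>"
proof -
  have [measurable]: "\<xi> \<in> borel_measurable (bern \<theta>)" "\<eta> \<in> borel_measurable (bern \<theta>)"
    using assms by (auto simp: L2_def)
  have "(cmod (\<xi> \<omega> + \<eta> \<omega>))\<^sup>2 \<le> 2 * (cmod (\<xi> \<omega>))\<^sup>2 + 2 * (cmod (\<eta> \<omega>))\<^sup>2" for \<omega>
  proof -
    have "(cmod (\<xi> \<omega> + \<eta> \<omega>))\<^sup>2 \<le> (cmod (\<xi> \<omega>) + cmod (\<eta> \<omega>))\<^sup>2"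
      by (intro power_mono norm_triangle_ineq) auto
    also have "\<dots> \<le> 2 * (cmod (\<xi> \<omega>))\<^sup>2 + 2 * (cmod (\<eta> \<omega>))\<^sup>2"
      using zero_le_power2[of "cmod (\<xi> \<omega>) - cmod (\<eta> \<omega>)"] by (simp add: power2_sum power2_diff)
    finally show ?thesis .
  qed
  moreover have "integrable (bern \<theta>) (\<lambda>\<omega>. 2 * (cmod (\<xi> \<omega>))\<^sup>2 + 2 * (cmod (\<eta> \<omega>))\<^sup>2)"
    using assms by (auto simp: L2_def)
  ultimately have "integrable (bern \<theta>) (\<lambda>\<omega>. (cmod (\<xi> \<omega> + \<eta> \<omega>))\<^sup>2)"
    by (elim Bochner_Integration.integrable_bound) auto
  then show ?thesis by (simp add: L2_def)
qed

lemma L2_cmult: "\<xi> \<in> L2 \<theta> \<Longrightarrow> (\<lambda>\<omega>. c * \<xi> \<omega>) \<in> L2 \<theta>"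
  by (auto simp: L2_def norm_mult power_mult_distrib)

text \<open>The Fourier coefficient with respect to the orthonormal system \<open>Z\<close>.\<close>

definition cf :: "((nat \<Rightarrow> real) \<Rightarrow> complex) \<Rightarrow> nat set \<Rightarrow> complex" where
  "cf \<xi> \<sigma> = L2_inner \<theta> (Z \<theta> \<sigma>) \<xi>"

text \<open>Additivity of the coefficients rests on this, since the integral of a sum is split for
  integrable functions. As \<open>Z\<close> is bounded by some \<open>B\<close>, the
  arithmetic-geometric inequality gives the majorant
  \<open>B\<^sup>2 + (cmod (\<xi> \<omega>))\<^sup>2\<close>, integrable on a probability
  space.\<close>

lemma integrable_cnj_Z_mult:
  assumes "\<xi> \<in> L2 \<theta>"
  shows "integrable (bern \<theta>) (\<lambda>\<omega>. cnj (Z \<theta> \<sigma> \<omega>) * \<xi> \<omega>)"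
proof -
  interpret prob_space "bern \<theta>" by (rule prob_space_bern) (rule theta_bounds)
  have meas: "\<xi> \<in> borel_measurable (bern \<theta>)" and
    sq: "integrable (bern \<theta>) (\<lambda>\<omega>. (cmod (\<xi> \<omega>))\<^sup>2)"
    using assms by (auto simp: L2_def)
  obtain B where B: "\<And>\<omega>. \<omega> \<in> space (bern \<theta>) \<Longrightarrow> cmod (Z \<theta> \<sigma> \<omega>) \<le> B"
    using Z_bounded by blast
  have "cmod (cnj (Z \<theta> \<sigma> \<omega>) * \<xi> \<omega>) \<le> B\<^sup>2 + (cmod (\<xi> \<omega>))\<^sup>2" if "\<omega> \<in> space (bern \<theta>)" for \<omega>
  proof -
    have "cmod (cnj (Z \<theta> \<sigma> \<omega>) * \<xi> \<omega>) \<le> B * cmod (\<xi> \<omega>)"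
      using B[OF that] by (simp add: norm_mult mult_right_mono)
    also have "\<dots> \<le> B\<^sup>2 + (cmod (\<xi> \<omega>))\<^sup>2"
    proof -
      have "2 * (B * cmod (\<xi> \<omega>)) \<le> B\<^sup>2 + (cmod (\<xi> \<omega>))\<^sup>2"
        using sum_squares_bound[of B "cmod (\<xi> \<omega>)"] by (simp add: mult.assoc)
      moreover have "0 \<le> B\<^sup>2 + (cmod (\<xi> \<omega>))\<^sup>2" by simp
      ultimately show ?thesis by linarith
    qed
    finally show ?thesis .
  qed
  then have "AE \<omega> in bern \<theta>. cmod (cnj (Z \<theta> \<sigma> \<omega>) * \<xi> \<omega>) \<le> norm (B\<^sup>2 + (cmod (\<xi> \<omega>))\<^sup>2)"
    by (intro AE_I2) simp
  moreover have "integrable (bern \<theta>) (\<lambda>\<omega>. B\<^sup>2 + (cmod (\<xi> \<omega>))\<^sup>2)"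
    using sq by simp
  moreover have "(\<lambda>\<omega>. cnj (Z \<theta> \<sigma> \<omega>) * \<xi> \<omega>) \<in> borel_measurable (bern \<theta>)"
    using measurable_compose[OF Z_measurable borel_measurable_continuous_onI, of cnj \<sigma>] meas
    by (intro borel_measurable_times) (auto intro: continuous_on_cnj continuous_on_id)
  ultimately show ?thesis
    using Bochner_Integration.integrable_bound by blast
qed

lemma cf_add:
  "\<xi> \<in> L2 \<theta> \<Longrightarrow> \<eta> \<in> L2 \<theta> \<Longrightarrow> cf (\<lambda>\<omega>. \<xi> \<omega> + \<eta> \<omega>) \<sigma> = cf \<xi> \<sigma> + cf \<eta> \<sigma>"
  by (simp add: cf_def L2_inner_def distrib_left integrable_cnj_Z_mult)

text \<open>The convention that a non-integrable function has integral 0 makes the rule valid for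
  every function \<open>\<xi>\<close>.\<close>

lemma cf_cmult: "cf (\<lambda>\<omega>. c * \<xi> \<omega>) \<sigma> = c * cf \<xi> \<sigma>"
proof -
  have "cnj (Z \<theta> \<sigma> \<omega>) * (c * \<xi> \<omega>) = c * (cnj (Z \<theta> \<sigma> \<omega>) * \<xi> \<omega>)" for \<omega> by simp
  then show ?thesis by (simp only: cf_def L2_inner_def integral_mult_right_zero)
qed

lemma cf_0: "cf (\<lambda>_. 0) \<sigma> = 0"
  by (simp add: cf_def L2_inner_def)

lemma cf_Z:
  "\<sigma> \<in> fin_subsets \<Longrightarrow> \<tau> \<in> fin_subsets \<Longrightarrow> cf (Z \<theta> \<tau>) \<sigma> = (if \<sigma> = \<tau> then 1 else 0)"
  unfolding cf_def by (rule Z_orthonormal)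

text \<open>The weight makes \<open>Sp_norm \<theta> p\<close> the square-sum norm of
  \<open>wcf p\<close>. Its finite partial norms are then instances of \<open>L2_set\<close>, for
  which the triangle inequality is available.\<close>

definition wcf :: "real \<Rightarrow> ((nat \<Rightarrow> real) \<Rightarrow> complex) \<Rightarrow> nat set \<Rightarrow> real" where
  "wcf p \<xi> \<sigma> = lam \<sigma> powr p * cmod (cf \<xi> \<sigma>)"

lemma wcf_nonneg: "0 \<le> wcf p \<xi> \<sigma>"
  by (simp add: wcf_def)

lemma wcf_square: "lam \<sigma> powr (2 * p) * (cmod (L2_inner \<theta> (Z \<theta> \<sigma>) \<xi>))\<^sup>2 = (wcf p \<xi> \<sigma>)\<^sup>2"
proof -
  have "lam \<sigma> powr (2 * p) = (lam \<sigma> powr p)\<^sup>2"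
    using lam_pos[of \<sigma>] by (simp add: powr_power mult.commute)
  then show ?thesis by (simp add: wcf_def cf_def power_mult_distrib)
qed

lemma Sp_norm_eq: "Sp_norm \<theta> p \<xi> = sqrt (\<Sum>\<^sub>\<infinity>\<sigma>\<in>fin_subsets. (wcf p \<xi> \<sigma>)\<^sup>2)"
  by (simp add: Sp_norm_def wcf_square)

lemma S_iff: "\<xi> \<in> S \<theta> \<longleftrightarrow> \<xi> \<in> L2 \<theta> \<and> (\<forall>p\<ge>0. (\<lambda>\<sigma>. (wcf p \<xi> \<sigma>)\<^sup>2) summable_on fin_subsets)"
  by (auto simp: S_def Sp_def wcf_square)

lemma S_L2: "\<xi> \<in> S \<theta> \<Longrightarrow> \<xi> \<in> L2 \<theta>"
  by (simp add: S_iff)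

lemma Sp_norm_nonneg: "0 \<le> Sp_norm \<theta> p \<xi>"
  unfolding Sp_norm_eq by (intro real_sqrt_ge_zero infsum_nonneg) auto

lemma L2_set_wcf_le:
  assumes "\<xi> \<in> S \<theta>" "0 \<le> p" "finite F" "F \<subseteq> fin_subsets"
  shows "L2_set (wcf p \<xi>) F \<le> Sp_norm \<theta> p \<xi>"
  unfolding L2_set_def Sp_norm_eq using assms
  by (intro real_sqrt_le_mono finite_sum_le_infsum) (auto simp: S_iff)

lemma wcf_le:
  assumes "\<xi> \<in> S \<theta>" "0 \<le> p" "\<sigma> \<in> fin_subsets"
  shows "wcf p \<xi> \<sigma> \<le> Sp_norm \<theta> p \<xi>"
  using L2_set_wcf_le[of \<xi> p "{\<sigma>}"] assms by (simp add: wcf_nonneg)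

text \<open>A single term of the sum of squares is at most the whole sum. This pointwise decay is
  what later makes the double series of a kernel converge.\<close>

lemma cf_le:
  assumes "\<xi> \<in> S \<theta>" "0 \<le> p" "\<sigma> \<in> fin_subsets"
  shows "cmod (cf \<xi> \<sigma>) \<le> Sp_norm \<theta> p \<xi> * lam \<sigma> powr - p"
  using wcf_le[OF assms] lam_pos[of \<sigma>] by (simp add: wcf_def powr_minus field_simps)

text \<open>Transfers a uniform estimate of finite partial norms to the full norm, so that
  \<open>S_add\<close> and \<open>Sp_norm_add\<close> both follow from the triangle inequality for
  \<open>L2_set\<close>.\<close>

lemma wcf_summableI:
  assumes "\<And>F. finite F \<Longrightarrow> F \<subseteq> fin_subsets \<Longrightarrow> L2_set (wcf p \<xi>) F \<le> b"
  shows "(\<lambda>\<sigma>. (wcf p \<xi> \<sigma>)\<^sup>2) summable_on fin_subsets" "Sp_norm \<theta> p \<xi> \<le> b"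
proof -
  \<comment> \<open>The empty partial norm shows that the bound is nonnegative, which permits
    squaring it.\<close>
  have b: "0 \<le> b" using assms[of "{}"] by simp
  have le: "(\<Sum>\<sigma>\<in>F. (wcf p \<xi> \<sigma>)\<^sup>2) \<le> b\<^sup>2" if "finite F" "F \<subseteq> fin_subsets" for F
    using assms[OF that] b unfolding L2_set_def by (simp add: real_sqrt_le_iff' sum_nonneg)
  show s: "(\<lambda>\<sigma>. (wcf p \<xi> \<sigma>)\<^sup>2) summable_on fin_subsets"
    by (rule nonneg_bdd_above_summable_on) (auto intro!: bdd_aboveI2 le)
  show "Sp_norm \<theta> p \<xi> \<le> b"
    unfolding Sp_norm_eq using b infsum_le_finite_sums[OF s le]
    by (intro real_le_lsqrt infsum_nonneg) auto
qed

lemma L2_set_wcf_add: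
  assumes "\<xi> \<in> S \<theta>" "\<eta> \<in> S \<theta>" "0 \<le> p" "finite F" "F \<subseteq> fin_subsets"
  shows "L2_set (wcf p (\<lambda>\<omega>. \<xi> \<omega> + \<eta> \<omega>)) F \<le> Sp_norm \<theta> p \<xi> + Sp_norm \<theta> p \<eta>"
proof -
  have "wcf p (\<lambda>\<omega>. \<xi> \<omega> + \<eta> \<omega>) \<sigma> \<le> wcf p \<xi> \<sigma> + wcf p \<eta> \<sigma>" for \<sigma>
    using assms by (simp add: wcf_def cf_add S_L2 norm_triangle_ineq mult_left_mono flip: distrib_left)
  then have "L2_set (wcf p (\<lambda>\<omega>. \<xi> \<omega> + \<eta> \<omega>)) F \<le> L2_set (\<lambda>\<sigma>. wcf p \<xi> \<sigma> + wcf p \<eta> \<sigma>) F"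
    by (intro L2_set_mono) (auto simp: wcf_nonneg)
  also have "\<dots> \<le> L2_set (wcf p \<xi>) F + L2_set (wcf p \<eta>) F"
    by (rule L2_set_triangle_ineq)
  also have "\<dots> \<le> Sp_norm \<theta> p \<xi> + Sp_norm \<theta> p \<eta>"
    using assms by (intro add_mono L2_set_wcf_le)
  finally show ?thesis .
qed

lemma S_add: "\<xi> \<in> S \<theta> \<Longrightarrow> \<eta> \<in> S \<theta> \<Longrightarrow> (\<lambda>\<omega>. \<xi> \<omega> + \<eta> \<omega>) \<in> S \<theta>"
  using wcf_summableI(1)[OF L2_set_wcf_add] by (subst S_iff) (auto intro: L2_add S_L2)

lemma Sp_norm_add:
  "\<xi> \<in> S \<theta> \<Longrightarrow> \<eta> \<in> S \<theta> \<Longrightarrow> 0 \<le> p \<Longrightarrow>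
    Sp_norm \<theta> p (\<lambda>\<omega>. \<xi> \<omega> + \<eta> \<omega>) \<le> Sp_norm \<theta> p \<xi> + Sp_norm \<theta> p \<eta>"
  by (rule wcf_summableI(2)[OF L2_set_wcf_add])

lemma wcf_cmult: "wcf p (\<lambda>\<omega>. c * \<xi> \<omega>) \<sigma> = cmod c * wcf p \<xi> \<sigma>"
  by (simp add: wcf_def cf_cmult norm_mult)

lemma S_cmult: "\<xi> \<in> S \<theta> \<Longrightarrow> (\<lambda>\<omega>. c * \<xi> \<omega>) \<in> S \<theta>"
  by (auto simp: S_iff wcf_cmult power_mult_distrib intro!: L2_cmult summable_on_cmult_right)

lemma Sp_norm_cmult: "Sp_norm \<theta> p (\<lambda>\<omega>. c * \<xi> \<omega>) = cmod c * Sp_norm \<theta> p \<xi>"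
  by (simp add: Sp_norm_eq wcf_cmult power_mult_distrib infsum_cmult_right' real_sqrt_mult)

lemma S_0: "(\<lambda>_. 0) \<in> S \<theta>"
  by (auto simp: S_iff wcf_def cf_0 L2_def)

lemma Sp_norm_0: "Sp_norm \<theta> p (\<lambda>_. 0) = 0"
  by (simp add: Sp_norm_eq wcf_def cf_0)

lemma S_diff:
  assumes "\<xi> \<in> S \<theta>" "\<eta> \<in> S \<theta>"
  shows "(\<lambda>\<omega>. \<xi> \<omega> - \<eta> \<omega>) \<in> S \<theta>"
  using S_add[OF assms(1) S_cmult[OF assms(2), of "-1"]] by simp

lemma Sp_norm_triangle:
  assumes "\<xi> \<in> S \<theta>" "\<eta> \<in> S \<theta>" "\<zeta> \<in> S \<theta>" "0 \<le> p"
  shows "Sp_norm \<theta> p (\<lambda>\<omega>. \<xi> \<omega> - \<zeta> \<omega>) \<le>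
    Sp_norm \<theta> p (\<lambda>\<omega>. \<xi> \<omega> - \<eta> \<omega>) + Sp_norm \<theta> p (\<lambda>\<omega>. \<eta> \<omega> - \<zeta> \<omega>)"
  using Sp_norm_add[OF S_diff[OF assms(1,2)] S_diff[OF assms(2,3)] assms(4)] by simp

text \<open>Since \<open>lam\<close> is at least 1, its powers increase with the exponent. The norms
  therefore form a directed family.\<close>

lemma Sp_norm_mono:
  assumes "\<xi> \<in> S \<theta>" "0 \<le> p" "p \<le> q"
  shows "Sp_norm \<theta> p \<xi> \<le> Sp_norm \<theta> q \<xi>"
  unfolding Sp_norm_eq
proof (intro real_sqrt_le_mono infsum_mono power_mono)
  show "wcf p \<xi> \<sigma> \<le> wcf q \<xi> \<sigma>" for \<sigma>
    using assms lam_ge_1[of \<sigma>] by (auto simp: wcf_def intro!: mult_right_mono powr_mono)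
qed (use assms in \<open>auto simp: S_iff wcf_nonneg\<close>)

lemma Z_L2: "Z \<theta> \<sigma> \<in> L2 \<theta>"
proof -
  note Z_measurable[measurable]
  obtain B where B: "\<And>\<omega>. \<omega> \<in> space (bern \<theta>) \<Longrightarrow> cmod (Z \<theta> \<sigma> \<omega>) \<le> B"
    using Z_bounded by blast
  have "integrable (bern \<theta>) (\<lambda>\<omega>. (cmod (Z \<theta> \<sigma> \<omega>))\<^sup>2)"
    by (rule integrable_bern_bounded[of _ "B\<^sup>2"]) (auto intro!: power_mono B)
  then show ?thesis by (simp add: L2_def Z_measurable)
qed

text \<open>By orthonormality the only nonzero coefficient is the one at
  \<open>\<sigma>\<close>.\<close>

lemma Z_S:
  assumes "\<sigma> \<in> fin_subsets"
  shows "Z \<theta> \<sigma> \<in> S \<theta>"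
proof -
  have "(\<lambda>\<tau>. (wcf p (Z \<theta> \<sigma>) \<tau>)\<^sup>2) summable_on fin_subsets" for p
    using assms
    by (intro summable_on_cong_neutral[THEN iffD1, OF _ _ _ summable_on_finite[of "{\<sigma>}"]])
      (auto simp: wcf_def cf_Z)
  then show ?thesis by (simp add: S_iff Z_L2)
qed

lemma S_sum:
  assumes "finite F" "\<And>\<sigma>. \<sigma> \<in> F \<Longrightarrow> \<xi> \<sigma> \<in> S \<theta>"
  shows "(\<lambda>\<omega>. \<Sum>\<sigma>\<in>F. \<xi> \<sigma> \<omega>) \<in> S \<theta>"
  using assms by (induction F) (auto intro: S_0 S_add)

lemma cf_sum:
  assumes "finite F" "\<And>\<sigma>. \<sigma> \<in> F \<Longrightarrow> \<xi> \<sigma> \<in> S \<theta>"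
  shows "cf (\<lambda>\<omega>. \<Sum>\<sigma>\<in>F. \<xi> \<sigma> \<omega>) \<tau> = (\<Sum>\<sigma>\<in>F. cf (\<xi> \<sigma>) \<tau>)"
  using assms by (induction F) (auto simp: cf_0 cf_add S_L2 S_sum)

section \<open>Open sets and bounded sets of test functions\<close>

text \<open>The generating balls are a priori only a subbase. Directedness of the norms and the
  triangle inequality turn them into a base, with one ball centred at each point, so that a single
  norm suffices in every later continuity argument.\<close>

lemma openin_S_top_iff:
  "openin (S_top \<theta>) U \<longleftrightarrow> U \<subseteq> S \<theta> \<and>
    (\<forall>\<xi>\<in>U. \<exists>p\<ge>0. \<exists>r>0. \<forall>\<eta>\<in>S \<theta>. Sp_norm \<theta> p (\<lambda>\<omega>. \<eta> \<omega> - \<xi> \<omega>) < r \<longrightarrow> \<eta> \<in> U)"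
  (is "_ \<longleftrightarrow> ?R U")
proof
  assume "openin (S_top \<theta>) U"
  then have "generate_topology_on
     {{\<eta> \<in> S \<theta>. Sp_norm \<theta> p (\<lambda>\<omega>. \<eta> \<omega> - \<xi> \<omega>) < r} | \<xi> p r. \<xi> \<in> S \<theta> \<and> 0 \<le> p \<and> 0 < r} U"
    unfolding S_top_def by (rule openin_topology_generated_by)
  then show "?R U"
  proof induction
    case (Int U V)
    show ?case
    proof (intro conjI ballI)
      fix \<xi> assume \<xi>: "\<xi> \<in> U \<inter> V"
      obtain p r where p: "p \<ge> 0" "r > 0" "\<forall>\<eta>\<in>S \<theta>. Sp_norm \<theta> p (\<lambda>\<omega>. \<eta> \<omega> - \<xi> \<omega>) < r \<longrightarrow> \<eta> \<in> U"
        using Int \<xi> by blast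
      obtain q s where q: "q \<ge> 0" "s > 0" "\<forall>\<eta>\<in>S \<theta>. Sp_norm \<theta> q (\<lambda>\<omega>. \<eta> \<omega> - \<xi> \<omega>) < s \<longrightarrow> \<eta> \<in> V"
        using Int \<xi> by blast
      \<comment> \<open>The larger order and the smaller radius serve both sets by monotonicity of
        the norms.\<close>
      have "\<eta> \<in> U \<inter> V" if "\<eta> \<in> S \<theta>" "Sp_norm \<theta> (max p q) (\<lambda>\<omega>. \<eta> \<omega> - \<xi> \<omega>) < min r s" for \<eta>
      proof -
        have "(\<lambda>\<omega>. \<eta> \<omega> - \<xi> \<omega>) \<in> S \<theta>" using Int \<xi> that by (intro S_diff) auto
        then show ?thesis
          using that p q Sp_norm_mono[of "\<lambda>\<omega>. \<eta> \<omega> - \<xi> \<omega>" p "max p q"]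
            Sp_norm_mono[of "\<lambda>\<omega>. \<eta> \<omega> - \<xi> \<omega>" q "max p q"] by force
      qed
      moreover have "max p q \<ge> 0" "min r s > 0" using p q by auto
      ultimately show "\<exists>p\<ge>0. \<exists>r>0. \<forall>\<eta>\<in>S \<theta>. Sp_norm \<theta> p (\<lambda>\<omega>. \<eta> \<omega> - \<xi> \<omega>) < r \<longrightarrow> \<eta> \<in> U \<inter> V"
        by blast
    qed (use Int in auto)
  next
    case (Basis U)
    then obtain \<zeta> p r where U: "U = {\<eta> \<in> S \<theta>. Sp_norm \<theta> p (\<lambda>\<omega>. \<eta> \<omega> - \<zeta> \<omega>) < r}"
      "\<zeta> \<in> S \<theta>" "0 \<le> p" "0 < r" by blast
    show ?case
    proof (intro conjI ballI)
      fix \<xi> assume \<xi>: "\<xi> \<in> U"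
      \<comment> \<open>The radius left over when the ball around \<open>\<zeta>\<close> is
        recentred at \<open>\<xi>\<close>.\<close>
      define s where "s = r - Sp_norm \<theta> p (\<lambda>\<omega>. \<xi> \<omega> - \<zeta> \<omega>)"
      have "\<eta> \<in> U" if "\<eta> \<in> S \<theta>" "Sp_norm \<theta> p (\<lambda>\<omega>. \<eta> \<omega> - \<xi> \<omega>) < s" for \<eta>
        using that U \<xi> Sp_norm_triangle[of \<eta> \<xi> \<zeta> p] by (simp add: s_def)
      moreover have "0 < s" using \<xi> U by (simp add: s_def)
      ultimately show "\<exists>p\<ge>0. \<exists>r>0. \<forall>\<eta>\<in>S \<theta>. Sp_norm \<theta> p (\<lambda>\<omega>. \<eta> \<omega> - \<xi> \<omega>) < r \<longrightarrow> \<eta> \<in> U"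
        using U(3) by blast
    qed (use U in auto)
  next
    case (UN K)
    show ?case
    proof (intro conjI ballI)
      fix \<xi> assume "\<xi> \<in> \<Union>K"
      then obtain U where U: "\<xi> \<in> U" "U \<in> K" by blast
      then obtain p r where "p \<ge> 0" "r > 0" "\<forall>\<eta>\<in>S \<theta>. Sp_norm \<theta> p (\<lambda>\<omega>. \<eta> \<omega> - \<xi> \<omega>) < r \<longrightarrow> \<eta> \<in> U"
        using UN(2)[OF U(2)] by blast
      then show "\<exists>p\<ge>0. \<exists>r>0. \<forall>\<eta>\<in>S \<theta>. Sp_norm \<theta> p (\<lambda>\<omega>. \<eta> \<omega> - \<xi> \<omega>) < r \<longrightarrow> \<eta> \<in> \<Union>K"
        using U(2) by blast
    qed (use UN in blast)
  qed simp
next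
  assume R: "?R U"
  show "openin (S_top \<theta>) U"
  proof (subst openin_subopen, intro ballI)
    fix \<xi> assume \<xi>: "\<xi> \<in> U"
    then obtain p r where p: "p \<ge> 0" "r > 0" "\<forall>\<eta>\<in>S \<theta>. Sp_norm \<theta> p (\<lambda>\<omega>. \<eta> \<omega> - \<xi> \<omega>) < r \<longrightarrow> \<eta> \<in> U"
      using R by blast
    have \<xi>S: "\<xi> \<in> S \<theta>" using R \<xi> by blast
    have "openin (S_top \<theta>) {\<eta> \<in> S \<theta>. Sp_norm \<theta> p (\<lambda>\<omega>. \<eta> \<omega> - \<xi> \<omega>) < r}"
      unfolding S_top_def by (rule topology_generated_by_Basis) (use p \<xi>S in blast)
    then show "\<exists>T. openin (S_top \<theta>) T \<and> \<xi> \<in> T \<and> T \<subseteq> U"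
      using p \<xi>S Sp_norm_0
      by (intro exI[of _ "{\<eta> \<in> S \<theta>. Sp_norm \<theta> p (\<lambda>\<omega>. \<eta> \<omega> - \<xi> \<omega>) < r}"]) auto
  qed
qed

lemma openin_S_topD:
  assumes "openin (S_top \<theta>) U" "\<xi> \<in> U"
  shows "\<exists>p\<ge>0. \<exists>r>0. \<forall>\<eta>\<in>S \<theta>. Sp_norm \<theta> p (\<lambda>\<omega>. \<eta> \<omega> - \<xi> \<omega>) < r \<longrightarrow> \<eta> \<in> U"
  using assms unfolding openin_S_top_iff by blast

lemma topspace_S_top: "topspace (S_top \<theta>) = S \<theta>"
proof
  show "topspace (S_top \<theta>) \<subseteq> S \<theta>"
    using openin_topspace[of "S_top \<theta>"] unfolding openin_S_top_iff by (rule conjunct1)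
  have "openin (S_top \<theta>) (S \<theta>)"
    unfolding openin_S_top_iff by (intro conjI ballI exI[where x = 1]) auto
  then show "S \<theta> \<subseteq> topspace (S_top \<theta>)" by (rule openin_subset)
qed

lemma openin_S_top_ball:
  assumes "0 \<le> p" "0 < r"
  shows "openin (S_top \<theta>) {\<eta> \<in> S \<theta>. Sp_norm \<theta> p \<eta> < r}"
proof -
  have "openin (S_top \<theta>) {\<eta> \<in> S \<theta>. Sp_norm \<theta> p (\<lambda>\<omega>. \<eta> \<omega> - \<xi> \<omega>) < r}" if "\<xi> \<in> S \<theta>" for \<xi>
    unfolding S_top_def by (rule topology_generated_by_Basis) (use assms that in blast)
  from this[OF S_0] show ?thesis by simp
qed

text \<open>The open unit ball of order \<open>p\<close> is a neighbourhood of 0 and so absorbs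
  \<open>B\<close>. Any admissible scaling factor, here \<open>s + 1\<close>, bounds the norm on
  \<open>B\<close>.\<close>

lemma S_boundedD:
  assumes "S_bounded \<theta> B" "0 \<le> p"
  shows "\<exists>M>0. \<forall>\<xi>\<in>B. Sp_norm \<theta> p \<xi> \<le> M"
proof -
  let ?U = "{\<eta> \<in> S \<theta>. Sp_norm \<theta> p \<eta> < 1}"
  have "openin (S_top \<theta>) ?U" "(\<lambda>_. 0) \<in> ?U"
    using assms by (simp_all add: openin_S_top_ball S_0 Sp_norm_0)
  then obtain s where s: "s > 0" "\<And>t. t > s \<Longrightarrow> B \<subseteq> (\<lambda>\<xi> \<omega>. complex_of_real t * \<xi> \<omega>) ` ?U"
    using assms unfolding S_bounded_def by blast
  have "Sp_norm \<theta> p \<xi> \<le> s + 1" if "\<xi> \<in> B" for \<xi>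
  proof -
    have "\<xi> \<in> (\<lambda>\<xi> \<omega>. complex_of_real (s + 1) * \<xi> \<omega>) ` ?U"
      by (rule subsetD[OF s(2) that]) simp
    then obtain \<eta> where \<eta>: "\<xi> = (\<lambda>\<omega>. complex_of_real (s + 1) * \<eta> \<omega>)" "\<eta> \<in> ?U"
      by (rule imageE)
    have "Sp_norm \<theta> p \<xi> = \<bar>s + 1\<bar> * Sp_norm \<theta> p \<eta>"
      unfolding \<eta>(1) Sp_norm_cmult by (simp only: norm_of_real)
    also have "\<dots> \<le> (s + 1) * 1"
      using s \<eta>(2) by (auto intro!: mult_mono simp: Sp_norm_nonneg)
    finally show ?thesis by simp
  qed
  then show ?thesis using s by (intro exI[of _ "s + 1"]) auto
qed

text \<open>With singletons as test sets the strong topology controls pointwise values: this yields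
  its underlying set and the continuity of evaluations.\<close>

lemma S_bounded_singleton:
  assumes "\<eta> \<in> S \<theta>"
  shows "S_bounded \<theta> {\<eta>}"
  unfolding S_bounded_def
proof (intro conjI allI impI)
  fix U assume U: "openin (S_top \<theta>) U \<and> (\<lambda>_. 0) \<in> U"
  obtain p r where p: "p \<ge> 0" "r > 0" "\<forall>\<xi>\<in>S \<theta>. Sp_norm \<theta> p \<xi> < r \<longrightarrow> \<xi> \<in> U"
    using openin_S_topD[OF conjunct1[OF U] conjunct2[OF U]] by auto
  \<comment> \<open>The added 1 keeps \<open>s\<close> positive even when the norm of
    \<open>\<eta>\<close> vanishes.\<close>
  define s where "s = (Sp_norm \<theta> p \<eta> + 1) / r"
  have s: "s > 0" using p Sp_norm_nonneg[of p \<eta>] by (auto simp: s_def intro!: divide_pos_pos)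
  have "\<eta> \<in> (\<lambda>\<xi> \<omega>. complex_of_real t * \<xi> \<omega>) ` U" if "t > s" for t
  proof
    have t: "t > 0" using that s by simp
    then show "\<eta> = (\<lambda>\<omega>. complex_of_real t * (\<lambda>\<omega>. complex_of_real (1 / t) * \<eta> \<omega>) \<omega>)" by simp
    have "Sp_norm \<theta> p (\<lambda>\<omega>. complex_of_real (1 / t) * \<eta> \<omega>) = Sp_norm \<theta> p \<eta> / t"
      unfolding Sp_norm_cmult norm_of_real using t by simp
    also have "\<dots> < r" using that t p(2) by (simp add: s_def field_simps)
    finally show "(\<lambda>\<omega>. complex_of_real (1 / t) * \<eta> \<omega>) \<in> U"
      using p(3) S_cmult[OF assms] by blast
  qed
  then show "\<exists>s>0. \<forall>t>s. {\<eta>} \<subseteq> (\<lambda>\<xi> \<omega>. complex_of_real t * \<xi> \<omega>) ` U"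
    using s by blast
qed (use assms in auto)

text \<open>Serves to intersect two strong neighbourhoods, whose test sets are merged.\<close>

lemma S_bounded_Un:
  assumes "S_bounded \<theta> A" "S_bounded \<theta> B"
  shows "S_bounded \<theta> (A \<union> B)"
  unfolding S_bounded_def
proof (intro conjI allI impI)
  fix U assume U: "openin (S_top \<theta>) U \<and> (\<lambda>_. 0) \<in> U"
  obtain s where s: "s > 0" "\<forall>t>s. A \<subseteq> (\<lambda>\<xi> \<omega>. complex_of_real t * \<xi> \<omega>) ` U"
    using assms(1) U unfolding S_bounded_def by blast
  obtain s' where s': "s' > 0" "\<forall>t>s'. B \<subseteq> (\<lambda>\<xi> \<omega>. complex_of_real t * \<xi> \<omega>) ` U"
    using assms(2) U unfolding S_bounded_def by blast
  show "\<exists>s>0. \<forall>t>s. A \<union> B \<subseteq> (\<lambda>\<xi> \<omega>. complex_of_real t * \<xi> \<omega>) ` U"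
    by (rule exI[of _ "max s s'"]) (use s s' in auto)
qed (use assms in \<open>auto simp: S_bounded_def\<close>)

subsection \<open>Generalized functionals and the strong topology\<close>

lemma
  assumes "\<Phi> \<in> Sdual \<theta>"
  shows Sdual_add: "\<xi> \<in> S \<theta> \<Longrightarrow> \<eta> \<in> S \<theta> \<Longrightarrow> \<Phi> (\<lambda>\<omega>. \<xi> \<omega> + \<eta> \<omega>) = \<Phi> \<xi> + \<Phi> \<eta>"
    and Sdual_cmult: "\<xi> \<in> S \<theta> \<Longrightarrow> \<Phi> (\<lambda>\<omega>. c * \<xi> \<omega>) = c * \<Phi> \<xi>"
    and Sdual_continuous: "continuous_map (S_top \<theta>) euclidean \<Phi>"
    and Sdual_extensional: "\<Phi> \<in> extensional (S \<theta>)"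
  using assms unfolding Sdual_def by blast+

lemma Sdual_0: "\<Phi> \<in> Sdual \<theta> \<Longrightarrow> \<Phi> (\<lambda>_. 0) = 0"
  using Sdual_cmult[of \<Phi> "\<lambda>_. 0" 0] S_0 by simp

lemma Sdual_diff:
  assumes "\<Phi> \<in> Sdual \<theta>" "\<xi> \<in> S \<theta>" "\<eta> \<in> S \<theta>"
  shows "\<Phi> (\<lambda>\<omega>. \<xi> \<omega> - \<eta> \<omega>) = \<Phi> \<xi> - \<Phi> \<eta>"
  using Sdual_add[OF assms(1,2) S_cmult[OF assms(3), of "-1"]] Sdual_cmult[OF assms(1,3), of "-1"]
  by simp

lemma Sdual_sum:
  assumes "\<Phi> \<in> Sdual \<theta>" "finite F" "\<And>\<sigma>. \<sigma> \<in> F \<Longrightarrow> \<xi> \<sigma> \<in> S \<theta>"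
  shows "\<Phi> (\<lambda>\<omega>. \<Sum>\<sigma>\<in>F. \<xi> \<sigma> \<omega>) = (\<Sum>\<sigma>\<in>F. \<Phi> (\<xi> \<sigma>))"
  using assms(2,3)
proof (induction F)
  case empty
  show ?case using Sdual_0[OF assms(1)] by simp
next
  case (insert \<sigma> F)
  then have "(\<lambda>\<omega>. \<Sum>\<tau>\<in>F. \<xi> \<tau> \<omega>) \<in> S \<theta>" by (intro S_sum) auto
  with insert show ?case by (simp add: Sdual_add[OF assms(1)])
qed

text \<open>Continuity at 0 yields a ball of radius \<open>r\<close> on which the functional stays
  below 1. A violation of the bound, rescaled so that the functional has modulus 1 there, would lie
  in that ball.\<close>

lemma Sdual_bound:
  assumes "\<Phi> \<in> Sdual \<theta>"
  shows "\<exists>p\<ge>0. \<exists>C\<ge>0. \<forall>\<xi>\<in>S \<theta>. cmod (\<Phi> \<xi>) \<le> C * Sp_norm \<theta> p \<xi>"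
proof -
  let ?U = "{\<xi> \<in> S \<theta>. \<Phi> \<xi> \<in> ball 0 1}"
  have "openin (S_top \<theta>) ?U"
    using openin_continuous_map_preimage[OF Sdual_continuous[OF assms], of "ball 0 1"]
    by (simp add: topspace_S_top)
  moreover have "(\<lambda>_. 0) \<in> ?U"
    using Sdual_0[OF assms] S_0 by simp
  ultimately obtain p r where p: "p \<ge> 0" "r > 0"
    "\<And>\<xi>. \<xi> \<in> S \<theta> \<Longrightarrow> Sp_norm \<theta> p \<xi> < r \<Longrightarrow> cmod (\<Phi> \<xi>) < 1"
    using openin_S_topD[of ?U "\<lambda>_. 0"] by auto
  have "cmod (\<Phi> \<xi>) \<le> (1 / r) * Sp_norm \<theta> p \<xi>" if \<xi>: "\<xi> \<in> S \<theta>" for \<xi>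
  proof (rule ccontr)
    assume "\<not> ?thesis"
    then have lt: "Sp_norm \<theta> p \<xi> < r * cmod (\<Phi> \<xi>)"
      using p(2) by (simp add: field_simps)
    then have "0 < r * cmod (\<Phi> \<xi>)"
      using Sp_norm_nonneg[of p \<xi>] by linarith
    then have pos: "cmod (\<Phi> \<xi>) > 0"
      using p(2) by (simp add: zero_less_mult_iff)
    let ?c = "complex_of_real (1 / cmod (\<Phi> \<xi>))"
    have "Sp_norm \<theta> p (\<lambda>\<omega>. ?c * \<xi> \<omega>) = Sp_norm \<theta> p \<xi> / cmod (\<Phi> \<xi>)"
      unfolding Sp_norm_cmult norm_of_real using pos by simp
    also have "\<dots> < r" using lt pos by (simp add: field_simps)
    finally have "cmod (\<Phi> (\<lambda>\<omega>. ?c * \<xi> \<omega>)) < 1"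
      using p(3) S_cmult[OF \<xi>] by blast
    moreover have "cmod (\<Phi> (\<lambda>\<omega>. ?c * \<xi> \<omega>)) = 1"
      unfolding Sdual_cmult[OF assms \<xi>] norm_mult norm_of_real using pos by simp
    ultimately show False by simp
  qed
  moreover have "0 \<le> 1 / r" using p(2) by simp
  ultimately show ?thesis using p(1) by blast
qed

text \<open>Converse of \<open>Sdual_bound\<close>: by linearity, domination by one norm controls
  differences of values and hence gives continuity at every point.\<close>

lemma SdualI:
  assumes ext: "\<Phi> \<in> extensional (S \<theta>)"
    and add: "\<And>\<xi> \<eta>. \<xi> \<in> S \<theta> \<Longrightarrow> \<eta> \<in> S \<theta> \<Longrightarrow> \<Phi> (\<lambda>\<omega>. \<xi> \<omega> + \<eta> \<omega>) = \<Phi> \<xi> + \<Phi> \<eta>"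
    and cmult: "\<And>c \<xi>. \<xi> \<in> S \<theta> \<Longrightarrow> \<Phi> (\<lambda>\<omega>. c * \<xi> \<omega>) = c * \<Phi> \<xi>"
    and bound: "\<And>\<xi>. \<xi> \<in> S \<theta> \<Longrightarrow> cmod (\<Phi> \<xi>) \<le> C * Sp_norm \<theta> p \<xi>"
    and p: "0 \<le> p"
  shows "\<Phi> \<in> Sdual \<theta>"
proof -
  have diff: "\<Phi> (\<lambda>\<omega>. \<xi> \<omega> - \<eta> \<omega>) = \<Phi> \<xi> - \<Phi> \<eta>" if "\<xi> \<in> S \<theta>" "\<eta> \<in> S \<theta>" for \<xi> \<eta>
    using add[OF that(1) S_cmult[OF that(2), of "-1"]] cmult[OF that(2), of "-1"] by simp
  have "openin (S_top \<theta>) {\<xi> \<in> S \<theta>. \<Phi> \<xi> \<in> U}" if U: "open U" for U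
    unfolding openin_S_top_iff
  proof (intro conjI ballI)
    fix \<xi> assume "\<xi> \<in> {\<xi> \<in> S \<theta>. \<Phi> \<xi> \<in> U}"
    then have \<xi>: "\<xi> \<in> S \<theta>" "\<Phi> \<xi> \<in> U" by auto
    obtain e where e: "e > 0" "\<And>y. dist y (\<Phi> \<xi>) < e \<Longrightarrow> y \<in> U"
      using bspec[OF iffD1[OF open_dist U] \<xi>(2)] by blast
    \<comment> \<open>The denominator \<open>\<bar>C\<bar> + 1\<close> is positive whatever the sign
      of \<open>C\<close>.\<close>
    have "\<Phi> \<eta> \<in> U" if \<eta>: "\<eta> \<in> S \<theta>" "Sp_norm \<theta> p (\<lambda>\<omega>. \<eta> \<omega> - \<xi> \<omega>) < e / (\<bar>C\<bar> + 1)" for \<eta>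
    proof (rule e(2))
      have "dist (\<Phi> \<eta>) (\<Phi> \<xi>) \<le> C * Sp_norm \<theta> p (\<lambda>\<omega>. \<eta> \<omega> - \<xi> \<omega>)"
        using bound[OF S_diff[OF \<eta>(1) \<xi>(1)]] by (simp add: dist_norm diff \<eta>(1) \<xi>(1))
      also have "\<dots> \<le> (\<bar>C\<bar> + 1) * Sp_norm \<theta> p (\<lambda>\<omega>. \<eta> \<omega> - \<xi> \<omega>)"
        by (intro mult_right_mono Sp_norm_nonneg) simp
      also have "\<dots> < e" using \<eta>(2) by (simp add: field_simps)
      finally show "dist (\<Phi> \<eta>) (\<Phi> \<xi>) < e" .
    qed
    moreover have "0 < e / (\<bar>C\<bar> + 1)" using e(1) by (simp add: add_nonneg_pos)
    ultimately show "\<exists>p\<ge>0. \<exists>r>0. \<forall>\<eta>\<in>S \<theta>. Sp_norm \<theta> p (\<lambda>\<omega>. \<eta> \<omega> - \<xi> \<omega>) < r \<longrightarrow>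
        \<eta> \<in> {\<xi> \<in> S \<theta>. \<Phi> \<xi> \<in> U}"
      using p by blast
  qed blast
  then have "continuous_map (S_top \<theta>) euclidean \<Phi>"
    by (simp add: continuous_map_def topspace_S_top)
  then show ?thesis unfolding Sdual_def using ext add cmult by blast
qed

text \<open>The tail of the expansion of \<open>\<xi>\<close> is small in each of the defining norms, whether or not
  the \<open>Z\<close> are complete, because these norms only see the coefficients.\<close>

lemma Sdual_has_sum:
  assumes \<Phi>: "\<Phi> \<in> Sdual \<theta>" and \<xi>: "\<xi> \<in> S \<theta>"
  shows "((\<lambda>\<sigma>. cf \<xi> \<sigma> * \<Phi> (Z \<theta> \<sigma>)) has_sum \<Phi> \<xi>) fin_subsets"
proof -
  obtain p C where p: "p \<ge> 0" and C: "\<And>\<xi>. \<xi> \<in> S \<theta> \<Longrightarrow> cmod (\<Phi> \<xi>) \<le> C * Sp_norm \<theta> p \<xi>"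
    using Sdual_bound[OF \<Phi>] by blast
  let ?w = "\<lambda>\<sigma>. (wcf p \<xi> \<sigma>)\<^sup>2"
  have w: "?w summable_on fin_subsets" using \<xi> p by (simp add: S_iff)
  have bound: "cmod ((\<Sum>\<sigma>\<in>F. cf \<xi> \<sigma> * \<Phi> (Z \<theta> \<sigma>)) - \<Phi> \<xi>) \<le> C * sqrt (infsum ?w fin_subsets - sum ?w F)"
    if F: "finite F" "F \<subseteq> fin_subsets" for F
  proof -
    let ?T = "\<lambda>\<omega>. \<Sum>\<sigma>\<in>F. cf \<xi> \<sigma> * Z \<theta> \<sigma> \<omega>"
    have ZS: "(\<lambda>\<omega>. cf \<xi> \<sigma> * Z \<theta> \<sigma> \<omega>) \<in> S \<theta>" if "\<sigma> \<in> F" for \<sigma>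
      using that F by (intro S_cmult Z_S) auto
    have T: "?T \<in> S \<theta>" using F ZS by (intro S_sum)
    \<comment> \<open>Orthonormality makes the coefficients of the partial sum those of
      \<open>\<xi>\<close> cut off to \<open>F\<close>. Hence the squared norm of
      \<open>?T - \<xi>\<close> is exactly the tail of the sum defining the squared norm of
      \<open>\<xi>\<close>.\<close>
    have cfT: "cf ?T \<tau> = (if \<tau> \<in> F then cf \<xi> \<tau> else 0)" if "\<tau> \<in> fin_subsets" for \<tau>
    proof -
      have "cf ?T \<tau> = (\<Sum>\<sigma>\<in>F. cf \<xi> \<sigma> * cf (Z \<theta> \<sigma>) \<tau>)"
        using F ZS by (simp add: cf_sum cf_cmult)
      also have "\<dots> = (\<Sum>\<sigma>\<in>F. if \<tau> = \<sigma> then cf \<xi> \<sigma> else 0)"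
        using that by (intro sum.cong refl) (simp add: cf_Z subsetD[OF F(2)])
      finally show ?thesis using F by simp
    qed
    have "cf (\<lambda>\<omega>. ?T \<omega> - \<xi> \<omega>) \<tau> = cf ?T \<tau> - cf \<xi> \<tau>" for \<tau>
      using cf_add[OF S_L2[OF T] L2_cmult[OF S_L2[OF \<xi>], of "-1"], of \<tau>] cf_cmult[of "-1" \<xi> \<tau>] by simp
    then have "wcf p (\<lambda>\<omega>. ?T \<omega> - \<xi> \<omega>) \<tau> = (if \<tau> \<in> F then 0 else wcf p \<xi> \<tau>)" if "\<tau> \<in> fin_subsets" for \<tau>
      using that by (simp add: wcf_def cfT)
    then have "Sp_norm \<theta> p (\<lambda>\<omega>. ?T \<omega> - \<xi> \<omega>) = sqrt (infsum ?w (fin_subsets - F))"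
      unfolding Sp_norm_eq by (intro arg_cong[of _ _ sqrt] infsum_cong_neutral) auto
    also have "infsum ?w (fin_subsets - F) = infsum ?w fin_subsets - sum ?w F"
      using infsum_Diff[OF w _ F(2)] F by simp
    finally have "cmod (\<Phi> (\<lambda>\<omega>. ?T \<omega> - \<xi> \<omega>)) \<le> C * sqrt (infsum ?w fin_subsets - sum ?w F)"
      using C[OF S_diff[OF T \<xi>]] by simp
    moreover have "\<Phi> ?T = (\<Sum>\<sigma>\<in>F. cf \<xi> \<sigma> * \<Phi> (Z \<theta> \<sigma>))"
      using F by (simp add: Sdual_sum[OF \<Phi>] ZS Sdual_cmult[OF \<Phi>] Z_S subset_iff)
    ultimately show ?thesis using Sdual_diff[OF \<Phi> T \<xi>] by simp
  qed
  have "((\<lambda>F. C * sqrt (infsum ?w fin_subsets - sum ?w F)) \<longlongrightarrow>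
      C * sqrt (infsum ?w fin_subsets - infsum ?w fin_subsets)) (finite_subsets_at_top fin_subsets)"
    by (intro tendsto_intros infsum_tendsto w)
  then have "((\<lambda>F. C * sqrt (infsum ?w fin_subsets - sum ?w F)) \<longlongrightarrow> 0) (finite_subsets_at_top fin_subsets)"
    by simp
  then have "((\<lambda>F. (\<Sum>\<sigma>\<in>F. cf \<xi> \<sigma> * \<Phi> (Z \<theta> \<sigma>)) - \<Phi> \<xi>) \<longlongrightarrow> 0) (finite_subsets_at_top fin_subsets)"
    by (rule Lim_null_comparison[rotated]) (auto intro!: eventually_finite_subsets_at_top_weakI bound)
  then show ?thesis
    unfolding has_sum_def by (rule LIM_zero_cancel)
qed

text \<open>Both functionals expand into the same series by \<open>Sdual_has_sum\<close>, and
  extensionality fixes them outside \<open>S \<theta>\<close>.\<close>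

lemma Sdual_eqI:
  assumes "\<Phi> \<in> Sdual \<theta>" "\<Psi> \<in> Sdual \<theta>"
    and "\<And>\<sigma>. \<sigma> \<in> fin_subsets \<Longrightarrow> \<Phi> (Z \<theta> \<sigma>) = \<Psi> (Z \<theta> \<sigma>)"
  shows "\<Phi> = \<Psi>"
proof (rule extensionalityI[OF assms(1,2)[THEN Sdual_extensional]])
  fix \<xi> assume "\<xi> \<in> S \<theta>"
  have "((\<lambda>\<sigma>. cf \<xi> \<sigma> * \<Phi> (Z \<theta> \<sigma>)) has_sum \<Phi> \<xi>) fin_subsets"
    by (rule Sdual_has_sum) fact+
  moreover have "((\<lambda>\<sigma>. cf \<xi> \<sigma> * \<Phi> (Z \<theta> \<sigma>)) has_sum \<Psi> \<xi>) fin_subsets"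
    using Sdual_has_sum[OF assms(2) \<open>\<xi> \<in> S \<theta>\<close>] has_sum_cong[of fin_subsets
      "\<lambda>\<sigma>. cf \<xi> \<sigma> * \<Phi> (Z \<theta> \<sigma>)" "\<lambda>\<sigma>. cf \<xi> \<sigma> * \<Psi> (Z \<theta> \<sigma>)"] assms(3) by simp
  ultimately show "\<Phi> \<xi> = \<Psi> \<xi>" by (rule has_sum_unique)
qed

text \<open>The suprema defining \<open>strong_top\<close> are taken in the reals, where they
  dominate their members only if the set is bounded above. Each functional is dominated by one norm,
  and every norm is bounded on \<open>B\<close>.\<close>

lemma Sdual_bdd_above:
  assumes "\<Phi> \<in> Sdual \<theta>" "\<Psi> \<in> Sdual \<theta>" "S_bounded \<theta> B"
  shows "bdd_above ((\<lambda>\<xi>. cmod (\<Psi> \<xi> - \<Phi> \<xi>)) ` B)"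
proof -
  have "\<exists>K. \<forall>\<xi>\<in>B. cmod (\<Phi> \<xi>) \<le> K" if \<Phi>: "\<Phi> \<in> Sdual \<theta>" for \<Phi>
  proof -
    obtain p C where p: "p \<ge> 0" "C \<ge> 0" "\<And>\<xi>. \<xi> \<in> S \<theta> \<Longrightarrow> cmod (\<Phi> \<xi>) \<le> C * Sp_norm \<theta> p \<xi>"
      using Sdual_bound[OF \<Phi>] by blast
    obtain M where M: "\<And>\<xi>. \<xi> \<in> B \<Longrightarrow> Sp_norm \<theta> p \<xi> \<le> M"
      using S_boundedD[OF assms(3) p(1)] by blast
    have "cmod (\<Phi> \<xi>) \<le> C * M" if "\<xi> \<in> B" for \<xi>
    proof -
      have "\<xi> \<in> S \<theta>" using that assms(3) by (auto simp: S_bounded_def)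
      from p(3)[OF this] show ?thesis
        using mult_left_mono[OF M[OF that] p(2)] by linarith
    qed
    then show ?thesis by blast
  qed
  from this[OF assms(1)] this[OF assms(2)] obtain K L
    where KL: "\<And>\<xi>. \<xi> \<in> B \<Longrightarrow> cmod (\<Phi> \<xi>) \<le> K" "\<And>\<xi>. \<xi> \<in> B \<Longrightarrow> cmod (\<Psi> \<xi>) \<le> L" by blast
  have "cmod (\<Psi> \<xi> - \<Phi> \<xi>) \<le> L + K" if "\<xi> \<in> B" for \<xi>
    using norm_triangle_ineq4[of "\<Psi> \<xi>" "\<Phi> \<xi>"] KL[OF that] by linarith
  then show ?thesis by (rule bdd_aboveI2)
qed

lemma topspace_strong_top: "topspace (strong_top \<theta>) = Sdual \<theta>"
proof
  show "topspace (strong_top \<theta>) \<subseteq> Sdual \<theta>"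
    unfolding strong_top_def topology_generated_by_topspace by blast
  show "Sdual \<theta> \<subseteq> topspace (strong_top \<theta>)"
  proof
    fix \<Phi> assume \<Phi>: "\<Phi> \<in> Sdual \<theta>"
    \<comment> \<open>The simplest nonempty bounded test set is \<open>{\<lambda>_. 0}\<close>; its
      basic neighbourhood centred at \<open>\<Phi>\<close> contains \<open>\<Phi>\<close>.\<close>
    have "{\<Psi> \<in> Sdual \<theta>. (SUP \<xi>\<in>{\<lambda>_. 0}. cmod (\<Psi> \<xi> - \<Phi> \<xi>)) < 1} \<in>
      {{\<Psi> \<in> Sdual \<theta>. (SUP \<xi>\<in>B. cmod (\<Psi> \<xi> - \<Phi> \<xi>)) < r} | \<Phi> B r.
        \<Phi> \<in> Sdual \<theta> \<and> S_bounded \<theta> B \<and> B \<noteq> {} \<and> 0 < r}"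
      using \<Phi> S_bounded_singleton[OF S_0] zero_less_one by blast
    moreover have "\<Phi> \<in> {\<Psi> \<in> Sdual \<theta>. (SUP \<xi>\<in>{\<lambda>_. 0}. cmod (\<Psi> \<xi> - \<Phi> \<xi>)) < 1}"
      using \<Phi> by simp
    ultimately show "\<Phi> \<in> topspace (strong_top \<theta>)"
      unfolding strong_top_def topology_generated_by_topspace by (rule UnionI)
  qed
qed

text \<open>Replaces the suprema of the subbase by a pointwise estimate on one bounded set centred
  at the given point, which is the form in which estimates for kernel operators arise.\<close>

lemma openin_strong_topD:
  assumes "openin (strong_top \<theta>) V" "\<Psi> \<in> V"
  shows "\<exists>B e. S_bounded \<theta> B \<and> e > 0 \<and>
    (\<forall>\<Psi>'\<in>Sdual \<theta>. (\<forall>\<xi>\<in>B. cmod (\<Psi>' \<xi> - \<Psi> \<xi>) \<le> e) \<longrightarrow> \<Psi>' \<in> V)"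
proof -
  have "generate_topology_on {{\<Psi> \<in> Sdual \<theta>. (SUP \<xi>\<in>B. cmod (\<Psi> \<xi> - \<Phi> \<xi>)) < r} | \<Phi> B r.
        \<Phi> \<in> Sdual \<theta> \<and> S_bounded \<theta> B \<and> B \<noteq> {} \<and> 0 < r} V"
    using assms unfolding strong_top_def by (intro openin_topology_generated_by)
  then show ?thesis using assms(2)
  proof (induction)
    case (Int V W)
    obtain A e where A: "S_bounded \<theta> A" "e > 0"
      "\<And>\<Psi>'. \<Psi>' \<in> Sdual \<theta> \<Longrightarrow> (\<forall>\<xi>\<in>A. cmod (\<Psi>' \<xi> - \<Psi> \<xi>) \<le> e) \<Longrightarrow> \<Psi>' \<in> V"
      using Int.IH(1) Int.prems by blast
    obtain B d where B: "S_bounded \<theta> B" "d > 0"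
      "\<And>\<Psi>'. \<Psi>' \<in> Sdual \<theta> \<Longrightarrow> (\<forall>\<xi>\<in>B. cmod (\<Psi>' \<xi> - \<Psi> \<xi>) \<le> d) \<Longrightarrow> \<Psi>' \<in> W"
      using Int.IH(2) Int.prems by blast
    have "\<Psi>' \<in> V \<inter> W" if "\<Psi>' \<in> Sdual \<theta>" "\<forall>\<xi>\<in>A \<union> B. cmod (\<Psi>' \<xi> - \<Psi> \<xi>) \<le> min e d" for \<Psi>'
      using that A(3)[of \<Psi>'] B(3)[of \<Psi>'] by simp
    moreover have "S_bounded \<theta> (A \<union> B)" "min e d > 0"
      using A B by (auto intro: S_bounded_Un)
    ultimately show ?case by blast
  next
    case (UN K)
    then obtain V where V: "V \<in> K" "\<Psi> \<in> V" by blast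
    obtain B e where "S_bounded \<theta> B" "e > 0"
      "\<And>\<Psi>'. \<Psi>' \<in> Sdual \<theta> \<Longrightarrow> (\<forall>\<xi>\<in>B. cmod (\<Psi>' \<xi> - \<Psi> \<xi>) \<le> e) \<Longrightarrow> \<Psi>' \<in> V"
      using UN.IH[OF V] by blast
    then show ?case using V(1) by blast
  next
    case (Basis V)
    then obtain \<Phi> B r where V: "V = {\<Psi> \<in> Sdual \<theta>. (SUP \<xi>\<in>B. cmod (\<Psi> \<xi> - \<Phi> \<xi>)) < r}"
      "\<Phi> \<in> Sdual \<theta>" "S_bounded \<theta> B" "B \<noteq> {}" by blast
    define s where "s = (SUP \<xi>\<in>B. cmod (\<Psi> \<xi> - \<Phi> \<xi>))"
    have s: "s < r" "\<Psi> \<in> Sdual \<theta>" using Basis.prems V(1) by (auto simp: s_def)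
    \<comment> \<open>Half of the gap \<open>r - s\<close> is spent, so the inequality remains
      strict after passing to the supremum.\<close>
    have "\<Psi>' \<in> V" if \<Psi>': "\<Psi>' \<in> Sdual \<theta>" "\<forall>\<xi>\<in>B. cmod (\<Psi>' \<xi> - \<Psi> \<xi>) \<le> (r - s) / 2" for \<Psi>'
    proof -
      have "cmod (\<Psi>' \<xi> - \<Phi> \<xi>) \<le> (r - s) / 2 + s" if "\<xi> \<in> B" for \<xi>
      proof -
        have "cmod (\<Psi> \<xi> - \<Phi> \<xi>) \<le> s"
          unfolding s_def by (intro cSUP_upper that Sdual_bdd_above V s)
        moreover have "cmod (\<Psi>' \<xi> - \<Psi> \<xi>) \<le> (r - s) / 2"
          using \<Psi>'(2) that by blast
        moreover have "cmod (\<Psi>' \<xi> - \<Phi> \<xi>) \<le> cmod (\<Psi>' \<xi> - \<Psi> \<xi>) + cmod (\<Psi> \<xi> - \<Phi> \<xi>)"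
          using norm_triangle_ineq[of "\<Psi>' \<xi> - \<Psi> \<xi>" "\<Psi> \<xi> - \<Phi> \<xi>"] by simp
        ultimately show ?thesis by linarith
      qed
      then have "(SUP \<xi>\<in>B. cmod (\<Psi>' \<xi> - \<Phi> \<xi>)) \<le> (r - s) / 2 + s"
        by (intro cSUP_least V(4))
      also have "\<dots> < r" using s(1) by (simp add: field_simps)
      finally show ?thesis using \<Psi>'(1) V(1) by simp
    qed
    moreover have "(r - s) / 2 > 0" using s(1) by simp
    ultimately show ?case using V(3) by blast
  qed simp
qed

text \<open>The test set is \<open>{\<eta>}\<close>. Composed with an operator, this gives
  continuity in the first argument with the second one fixed.\<close>

lemma continuous_map_strong_eval:
  assumes "\<eta> \<in> S \<theta>"
  shows "continuous_map (strong_top \<theta>) euclidean (\<lambda>\<Psi>. \<Psi> \<eta>)"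
  unfolding continuous_map_def topspace_strong_top
proof (intro conjI allI impI)
  fix U :: "complex set" assume "openin euclidean U"
  then have U: "open U" by simp
  show "openin (strong_top \<theta>) {\<Psi> \<in> Sdual \<theta>. \<Psi> \<eta> \<in> U}"
  proof (subst openin_subopen, intro ballI)
    fix \<Phi> assume "\<Phi> \<in> {\<Psi> \<in> Sdual \<theta>. \<Psi> \<eta> \<in> U}"
    then have \<Phi>: "\<Phi> \<in> Sdual \<theta>" "\<Phi> \<eta> \<in> U" by auto
    obtain e where e: "e > 0" "\<And>y. dist y (\<Phi> \<eta>) < e \<Longrightarrow> y \<in> U"
      using bspec[OF iffD1[OF open_dist U] \<Phi>(2)] by blast
    let ?T = "{\<Psi> \<in> Sdual \<theta>. (SUP \<xi>\<in>{\<eta>}. cmod (\<Psi> \<xi> - \<Phi> \<xi>)) < e}"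
    have "openin (strong_top \<theta>) ?T"
      unfolding strong_top_def
      by (rule topology_generated_by_Basis) (use \<Phi>(1) e(1) S_bounded_singleton[OF assms] in blast)
    moreover have "\<Phi> \<in> ?T" using \<Phi>(1) e(1) by simp
    moreover have "?T \<subseteq> {\<Psi> \<in> Sdual \<theta>. \<Psi> \<eta> \<in> U}" using e(2) by (auto simp: dist_norm)
    ultimately show "\<exists>T. openin (strong_top \<theta>) T \<and> \<Phi> \<in> T \<and> T \<subseteq> {\<Psi> \<in> Sdual \<theta>. \<Psi> \<eta> \<in> U}"
      by blast
  qed
qed simp

text \<open>\<open>Sdual_eqI\<close> is applied in one variable at a time: first to the second
  argument with the first one equal to some \<open>Z \<theta> \<sigma>\<close>, then to the first
  argument with an arbitrary second one.\<close>

lemma SSdual_ops_eqI: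
  assumes T: "T \<in> SSdual_ops \<theta>" and T': "T' \<in> SSdual_ops \<theta>"
    and fock: "\<And>\<sigma> \<tau>. \<sigma> \<in> fin_subsets \<Longrightarrow> \<tau> \<in> fin_subsets \<Longrightarrow> fock2 \<theta> T \<sigma> \<tau> = fock2 \<theta> T' \<sigma> \<tau>"
  shows "T = T'"
proof -
  have dual: "T \<xi> \<in> Sdual \<theta>" if "T \<in> SSdual_ops \<theta>" "\<xi> \<in> S \<theta>" for T \<xi>
    using that by (simp add: SSdual_ops_def)
  \<comment> \<open>The transposed functional is continuous as the composition of the operator with
    an evaluation.\<close>
  have dual': "(\<lambda>\<xi>\<in>S \<theta>. T \<xi> \<eta>) \<in> Sdual \<theta>" if T: "T \<in> SSdual_ops \<theta>" and \<eta>: "\<eta> \<in> S \<theta>" for T \<eta>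
  proof -
    have "continuous_map (S_top \<theta>) (strong_top \<theta>) T" using T by (simp add: SSdual_ops_def)
    from continuous_map_compose[OF this continuous_map_strong_eval[OF \<eta>]]
    have "continuous_map (S_top \<theta>) euclidean (\<lambda>\<xi>\<in>S \<theta>. T \<xi> \<eta>)"
      by (rule continuous_map_eq) (simp add: topspace_S_top)
    then show ?thesis
      using T \<eta> S_add S_cmult by (simp add: Sdual_def SSdual_ops_def)
  qed
  have "T (Z \<theta> \<sigma>) = T' (Z \<theta> \<sigma>)" if "\<sigma> \<in> fin_subsets" for \<sigma>
    using fock[OF that] by (intro Sdual_eqI dual T T' Z_S that) (simp add: fock2_def)
  then have "(\<lambda>\<xi>\<in>S \<theta>. T \<xi> \<eta>) = (\<lambda>\<xi>\<in>S \<theta>. T' \<xi> \<eta>)" if "\<eta> \<in> S \<theta>" for \<eta>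
    using that by (intro Sdual_eqI dual' T T') (simp_all add: Z_S)
  then have eq: "T \<xi> \<eta> = T' \<xi> \<eta>" if "\<xi> \<in> S \<theta>" "\<eta> \<in> S \<theta>" for \<xi> \<eta>
    using that by (metis restrict_apply')
  show ?thesis
  proof (rule extensionalityI[of _ "S \<theta>"])
    fix \<xi> assume \<xi>: "\<xi> \<in> S \<theta>"
    show "T \<xi> = T' \<xi>"
      using dual[OF T \<xi>] dual[OF T' \<xi>] eq[OF \<xi>] Sdual_extensional
      by (intro extensionalityI[of _ "S \<theta>"]) auto
  qed (use T T' in \<open>simp_all add: SSdual_ops_def\<close>)
qed

subsection \<open>Operators given by a kernel\<close>

text \<open>The terms of a weighted absolute-sum norm of the kernel. The weights are the decay
  factors that \<open>cf_le\<close> at order \<open>q\<close> gives for the coefficients of both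
  arguments.\<close>

definition fock_weight :: "real \<Rightarrow> (nat set \<Rightarrow> nat set \<Rightarrow> complex) \<Rightarrow> nat set \<times> nat set \<Rightarrow> real" where
  "fock_weight q G = (\<lambda>(\<sigma>, \<tau>). lam \<sigma> powr - q * lam \<tau> powr - q * cmod (G \<sigma> \<tau>))"

definition fock_form :: "(nat set \<Rightarrow> nat set \<Rightarrow> complex) \<Rightarrow>
    ((nat \<Rightarrow> real) \<Rightarrow> complex) \<Rightarrow> ((nat \<Rightarrow> real) \<Rightarrow> complex) \<Rightarrow> complex" where
  "fock_form G \<xi> \<eta> = (\<Sum>\<^sub>\<infinity>(\<sigma>, \<tau>)\<in>fin_subsets \<times> fin_subsets. cf \<xi> \<sigma> * cf \<eta> \<tau> * G \<sigma> \<tau>)"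

text \<open>Both arguments are restricted because \<open>SSdual_ops\<close> and \<open>Sdual\<close>
  consist of extensional functions.\<close>

definition fock_op :: "(nat set \<Rightarrow> nat set \<Rightarrow> complex) \<Rightarrow>
    ((nat \<Rightarrow> real) \<Rightarrow> complex) \<Rightarrow> ((nat \<Rightarrow> real) \<Rightarrow> complex) \<Rightarrow> complex" where
  "fock_op G = (\<lambda>\<xi>\<in>S \<theta>. \<lambda>\<eta>\<in>S \<theta>. fock_form G \<xi> \<eta>)"

text \<open>Of the order \<open>p + 2\<close>, the part \<open>p\<close> cancels the growth of the
  kernel and the remaining 2 leaves the summable power -2.\<close>

lemma fock_weight_le:
  assumes "cmod (G \<sigma> \<tau>) \<le> C * lam \<sigma> powr p * lam \<tau> powr p"
  shows "fock_weight (p + 2) G (\<sigma>, \<tau>) \<le> C * (lam \<sigma> powr -2 * lam \<tau> powr -2)"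
proof -
  have eq: "lam \<rho> powr - (p + 2) * lam \<rho> powr p = lam \<rho> powr -2" for \<rho>
    by (simp flip: powr_add)
  have "fock_weight (p + 2) G (\<sigma>, \<tau>) \<le>
      lam \<sigma> powr - (p + 2) * lam \<tau> powr - (p + 2) * (C * lam \<sigma> powr p * lam \<tau> powr p)"
    unfolding fock_weight_def case_prod_conv using assms by (intro mult_left_mono) auto
  also have "\<dots> = C * ((lam \<sigma> powr - (p + 2) * lam \<sigma> powr p) * (lam \<tau> powr - (p + 2) * lam \<tau> powr p))"
    by (simp only: mult_ac)
  finally show ?thesis unfolding eq .
qed

lemma fock_weight_nonneg: "0 \<le> fock_weight q G x"
  by (simp add: fock_weight_def split: prod.split)

lemma fock_weight_summable:
  assumes "\<And>\<sigma> \<tau>. \<sigma> \<in> fin_subsets \<Longrightarrow> \<tau> \<in> fin_subsets \<Longrightarrow> cmod (G \<sigma> \<tau>) \<le> C * lam \<sigma> powr p * lam \<tau> powr p"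
  shows "fock_weight (p + 2) G summable_on fin_subsets \<times> fin_subsets"
  by (rule summable_on_comparison_test[OF summable_on_cmult_right[OF summable_lam_powr_pairs, of C]])
    (auto simp: fock_weight_nonneg intro!: fock_weight_le assms)

text \<open>Applying \<open>cf_le\<close> to both coefficients dominates the double series termwise
  by the product of the two norms times \<open>fock_weight\<close>. This one domination gives both
  absolute convergence and the bound.\<close>

lemma
  assumes G: "fock_weight q G summable_on fin_subsets \<times> fin_subsets" and q: "0 \<le> q"
    and S: "\<xi> \<in> S \<theta>" "\<eta> \<in> S \<theta>"
  shows fock_form_abs_summable:
      "(\<lambda>x. cmod (case x of (\<sigma>, \<tau>) \<Rightarrow> cf \<xi> \<sigma> * cf \<eta> \<tau> * G \<sigma> \<tau>)) summable_on fin_subsets \<times> fin_subsets"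
    and fock_form_bound: "cmod (fock_form G \<xi> \<eta>) \<le>
      Sp_norm \<theta> q \<xi> * Sp_norm \<theta> q \<eta> * infsum (fock_weight q G) (fin_subsets \<times> fin_subsets)"
proof -
  let ?A = "fin_subsets \<times> fin_subsets" and ?c = "Sp_norm \<theta> q \<xi> * Sp_norm \<theta> q \<eta>"
  let ?f = "\<lambda>(\<sigma>, \<tau>). cf \<xi> \<sigma> * cf \<eta> \<tau> * G \<sigma> \<tau>"
  have le: "cmod (?f x) \<le> ?c * fock_weight q G x" if "x \<in> ?A" for x
  proof -
    obtain \<sigma> \<tau> where x: "x = (\<sigma>, \<tau>)" "\<sigma> \<in> fin_subsets" "\<tau> \<in> fin_subsets"
      using \<open>x \<in> ?A\<close> by blast
    have "cmod (cf \<xi> \<sigma>) * cmod (cf \<eta> \<tau>) \<le>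
        (Sp_norm \<theta> q \<xi> * lam \<sigma> powr - q) * (Sp_norm \<theta> q \<eta> * lam \<tau> powr - q)"
      using x q S by (intro mult_mono cf_le) (auto simp: Sp_norm_nonneg)
    from mult_right_mono[OF this, of "cmod (G \<sigma> \<tau>)"] show ?thesis
      by (simp add: x(1) fock_weight_def norm_mult mult_ac)
  qed
  have sum: "(\<lambda>x. ?c * fock_weight q G x) summable_on ?A"
    by (intro summable_on_cmult_right G)
  show abs: "(\<lambda>x. cmod (?f x)) summable_on ?A"
    using sum le by (rule Infinite_Sum.abs_summable_on_comparison_test')
  have "cmod (fock_form G \<xi> \<eta>) \<le> (\<Sum>\<^sub>\<infinity>x\<in>?A. cmod (?f x))"
    unfolding fock_form_def by (rule norm_infsum_bound) (rule abs)
  also have "\<dots> \<le> (\<Sum>\<^sub>\<infinity>x\<in>?A. ?c * fock_weight q G x)"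
    using abs sum le by (rule infsum_mono)
  also have "\<dots> = ?c * infsum (fock_weight q G) ?A"
    by (rule infsum_cmult_right')
  finally show "cmod (fock_form G \<xi> \<eta>) \<le> ?c * infsum (fock_weight q G) ?A" .
qed

context
  fixes q G
  assumes G: "fock_weight q G summable_on fin_subsets \<times> fin_subsets" and q: "0 \<le> q"
begin

lemma fock_form_summable:
  assumes "\<xi> \<in> S \<theta>" "\<eta> \<in> S \<theta>"
  shows "(\<lambda>(\<sigma>, \<tau>). cf \<xi> \<sigma> * cf \<eta> \<tau> * G \<sigma> \<tau>) summable_on fin_subsets \<times> fin_subsets"
  by (rule abs_summable_summable) (rule fock_form_abs_summable[OF G q assms])

lemma fock_form_add_left:
  assumes "\<xi> \<in> S \<theta>" "\<xi>' \<in> S \<theta>" "\<eta> \<in> S \<theta>"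
  shows "fock_form G (\<lambda>\<omega>. \<xi> \<omega> + \<xi>' \<omega>) \<eta> = fock_form G \<xi> \<eta> + fock_form G \<xi>' \<eta>"
  unfolding fock_form_def
  using infsum_add[OF fock_form_summable[OF assms(1,3)] fock_form_summable[OF assms(2,3)]] assms
  by (simp add: cf_add S_L2 distrib_right case_prod_unfold)

lemma fock_form_add_right:
  assumes "\<xi> \<in> S \<theta>" "\<eta> \<in> S \<theta>" "\<eta>' \<in> S \<theta>"
  shows "fock_form G \<xi> (\<lambda>\<omega>. \<eta> \<omega> + \<eta>' \<omega>) = fock_form G \<xi> \<eta> + fock_form G \<xi> \<eta>'"
  unfolding fock_form_def
  using infsum_add[OF fock_form_summable[OF assms(1,2)] fock_form_summable[OF assms(1,3)]] assms
  by (simp add: cf_add S_L2 distrib_right distrib_left case_prod_unfold)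

lemma fock_form_cmult_left: "fock_form G (\<lambda>\<omega>. c * \<xi> \<omega>) \<eta> = c * fock_form G \<xi> \<eta>"
  unfolding fock_form_def infsum_cmult_right'[symmetric]
  by (intro infsum_cong) (auto simp: cf_cmult mult_ac)

lemma fock_form_cmult_right: "fock_form G \<xi> (\<lambda>\<omega>. c * \<eta> \<omega>) = c * fock_form G \<xi> \<eta>"
  unfolding fock_form_def infsum_cmult_right'[symmetric]
  by (intro infsum_cong) (auto simp: cf_cmult mult_ac)

lemma fock_form_diff_left:
  assumes "\<xi> \<in> S \<theta>" "\<xi>' \<in> S \<theta>" "\<eta> \<in> S \<theta>"
  shows "fock_form G (\<lambda>\<omega>. \<xi> \<omega> - \<xi>' \<omega>) \<eta> = fock_form G \<xi> \<eta> - fock_form G \<xi>' \<eta>"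
  using fock_form_add_left[OF assms(1) S_cmult[OF assms(2), of "-1"] assms(3)]
    fock_form_cmult_left[of "-1" \<xi>' \<eta>] by simp

lemma fock_op_Sdual:
  assumes "\<xi> \<in> S \<theta>"
  shows "fock_op G \<xi> \<in> Sdual \<theta>"
proof (rule SdualI[where p = q])
  show "cmod (fock_op G \<xi> \<eta>) \<le>
      (Sp_norm \<theta> q \<xi> * infsum (fock_weight q G) (fin_subsets \<times> fin_subsets)) * Sp_norm \<theta> q \<eta>"
    if "\<eta> \<in> S \<theta>" for \<eta>
    using fock_form_bound[OF G q assms that] assms that by (simp add: fock_op_def mult_ac)
qed (use assms q in \<open>auto simp: fock_op_def S_add S_cmult fock_form_add_right fock_form_cmult_right\<close>)

text \<open>By linearity the difference of two values is the form at \<open>\<xi>' - \<xi>\<close>.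
  The bound \<open>fock_form_bound\<close> is uniform over a bounded test set, since the norm of
  order \<open>q\<close> is bounded there.\<close>

lemma fock_op_continuous: "continuous_map (S_top \<theta>) (strong_top \<theta>) (fock_op G)"
  unfolding continuous_map_def topspace_S_top topspace_strong_top
proof (intro conjI allI impI)
  show "fock_op G \<in> S \<theta> \<rightarrow> Sdual \<theta>"
    using fock_op_Sdual by blast
  fix V assume V: "openin (strong_top \<theta>) V"
  define K where "K = infsum (fock_weight q G) (fin_subsets \<times> fin_subsets)"
  have K: "K \<ge> 0" unfolding K_def by (intro infsum_nonneg fock_weight_nonneg)
  show "openin (S_top \<theta>) {\<xi> \<in> S \<theta>. fock_op G \<xi> \<in> V}"
    unfolding openin_S_top_iff
  proof (intro conjI ballI)
    fix \<xi> assume "\<xi> \<in> {\<xi> \<in> S \<theta>. fock_op G \<xi> \<in> V}"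
    then have \<xi>: "\<xi> \<in> S \<theta>" "fock_op G \<xi> \<in> V" by auto
    obtain B e where B: "S_bounded \<theta> B" "e > 0"
      "\<And>\<Psi>. \<Psi> \<in> Sdual \<theta> \<Longrightarrow> (\<forall>\<eta>\<in>B. cmod (\<Psi> \<eta> - fock_op G \<xi> \<eta>) \<le> e) \<Longrightarrow> \<Psi> \<in> V"
      using openin_strong_topD[OF V \<xi>(2)] by blast
    obtain M where M: "M > 0" "\<And>\<eta>. \<eta> \<in> B \<Longrightarrow> Sp_norm \<theta> q \<eta> \<le> M"
      using S_boundedD[OF B(1) q] by blast
    \<comment> \<open>The added 1 avoids a zero denominator when the kernel has weighted norm
      \<open>K = 0\<close>.\<close>
    define r where "r = e / (M * K + 1)"
    have pos: "M * K + 1 > 0" using M(1) K by (simp add: add_nonneg_pos)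
    have r: "r > 0" using B(2) pos by (simp add: r_def)
    have "fock_op G \<xi>' \<in> V" if \<xi>': "\<xi>' \<in> S \<theta>" "Sp_norm \<theta> q (\<lambda>\<omega>. \<xi>' \<omega> - \<xi> \<omega>) < r" for \<xi>'
    proof (intro B(3) ballI fock_op_Sdual \<xi>'(1))
      fix \<eta> assume \<eta>B: "\<eta> \<in> B"
      then have \<eta>: "\<eta> \<in> S \<theta>" using B(1) by (auto simp: S_bounded_def)
      have "cmod (fock_op G \<xi>' \<eta> - fock_op G \<xi> \<eta>) = cmod (fock_form G (\<lambda>\<omega>. \<xi>' \<omega> - \<xi> \<omega>) \<eta>)"
        using \<xi>(1) \<xi>'(1) \<eta> by (simp add: fock_op_def fock_form_diff_left)
      also have "\<dots> \<le> Sp_norm \<theta> q (\<lambda>\<omega>. \<xi>' \<omega> - \<xi> \<omega>) * Sp_norm \<theta> q \<eta> * K"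
        unfolding K_def by (rule fock_form_bound[OF G q S_diff[OF \<xi>'(1) \<xi>(1)] \<eta>])
      also have "\<dots> \<le> r * M * K"
        using \<xi>'(2) M(2)[OF \<eta>B] K r M(1)
        by (intro mult_right_mono mult_mono) (auto simp: Sp_norm_nonneg)
      also have "\<dots> \<le> r * (M * K + 1)" using r by (simp add: algebra_simps)
      also have "\<dots> = e" using pos by (simp add: r_def)
      finally show "cmod (fock_op G \<xi>' \<eta> - fock_op G \<xi> \<eta>) \<le> e" .
    qed
    then show "\<exists>p\<ge>0. \<exists>r>0. \<forall>\<eta>\<in>S \<theta>. Sp_norm \<theta> p (\<lambda>\<omega>. \<eta> \<omega> - \<xi> \<omega>) < r \<longrightarrow>
        \<eta> \<in> {\<xi> \<in> S \<theta>. fock_op G \<xi> \<in> V}"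
      using q r by blast
  qed blast
qed

lemma fock_op_SSdual_ops: "fock_op G \<in> SSdual_ops \<theta>"
  using fock_op_Sdual fock_op_continuous
  by (auto simp: SSdual_ops_def fock_op_def S_add S_cmult fock_form_add_left fock_form_cmult_left)

text \<open>Orthonormality leaves a single nonzero term in the double series.\<close>

lemma fock2_fock_op:
  assumes "\<sigma> \<in> fin_subsets" "\<tau> \<in> fin_subsets"
  shows "fock2 \<theta> (fock_op G) \<sigma> \<tau> = G \<sigma> \<tau>"
proof -
  have "fock_form G (Z \<theta> \<sigma>) (Z \<theta> \<tau>) = infsum (\<lambda>(\<sigma>, \<tau>). G \<sigma> \<tau>) {(\<sigma>, \<tau>)}"
    unfolding fock_form_def using assms by (intro infsum_cong_neutral) (auto simp: cf_Z split: if_splits)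
  then show ?thesis using assms by (simp add: fock2_def fock_op_def Z_S)
qed

end

section \<open>Spectral integrals as kernel operators and their convergence\<close>

text \<open>Resolves the definite description: the kernel operator has the prescribed transform, and
  \<open>SSdual_ops_eqI\<close> gives uniqueness.\<close>

lemma spectral_integral_eq:
  assumes "\<And>\<sigma> \<tau>. \<sigma> \<in> fin_subsets \<Longrightarrow> \<tau> \<in> fin_subsets \<Longrightarrow>
      cmod (\<Phi> (spectral_density \<theta> \<pi> \<sigma> \<tau>)) \<le> C * lam \<sigma> powr p * lam \<tau> powr p"
    and "0 \<le> p"
  shows "spectral_integral \<theta> \<pi> \<Phi> = fock_op (\<lambda>\<sigma> \<tau>. \<Phi> (spectral_density \<theta> \<pi> \<sigma> \<tau>))"
  unfolding spectral_integral_def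
proof (rule the_equality)
  let ?G = "\<lambda>\<sigma> \<tau>. \<Phi> (spectral_density \<theta> \<pi> \<sigma> \<tau>)"
  have G: "fock_weight (p + 2) ?G summable_on fin_subsets \<times> fin_subsets" and p: "0 \<le> p + 2"
    using assms by (auto intro: fock_weight_summable)
  show op: "fock_op ?G \<in> SSdual_ops \<theta> \<and>
    (\<forall>\<sigma>\<in>fin_subsets. \<forall>\<tau>\<in>fin_subsets. fock2 \<theta> (fock_op ?G) \<sigma> \<tau> = ?G \<sigma> \<tau>)"
    using fock_op_SSdual_ops[OF G p] fock2_fock_op[OF G p] by blast
  show "T = fock_op ?G" if "T \<in> SSdual_ops \<theta> \<and>
    (\<forall>\<sigma>\<in>fin_subsets. \<forall>\<tau>\<in>fin_subsets. fock2 \<theta> T \<sigma> \<tau> = ?G \<sigma> \<tau>)" for T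
    using that op by (intro SSdual_ops_eqI) auto
qed

text \<open>The difference of two kernel operators belongs to the difference kernel, whose weighted
  norm \<open>D n\<close> tends to 0 by dominated convergence. On a bounded test set the error is at
  most a constant times \<open>D n\<close>, uniformly.\<close>

lemma fock_op_tendsto:
  fixes G :: "nat \<Rightarrow> nat set \<Rightarrow> nat set \<Rightarrow> complex"
  assumes G: "\<forall>\<^sub>F n in sequentially. \<forall>\<sigma>\<in>fin_subsets. \<forall>\<tau>\<in>fin_subsets.
      cmod (G n \<sigma> \<tau>) \<le> C * lam \<sigma> powr p * lam \<tau> powr p"
    and G0: "\<And>\<sigma> \<tau>. \<sigma> \<in> fin_subsets \<Longrightarrow> \<tau> \<in> fin_subsets \<Longrightarrow>
      cmod (G0 \<sigma> \<tau>) \<le> C * lam \<sigma> powr p * lam \<tau> powr p"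
    and lim: "\<And>\<sigma> \<tau>. \<sigma> \<in> fin_subsets \<Longrightarrow> \<tau> \<in> fin_subsets \<Longrightarrow> (\<lambda>n. G n \<sigma> \<tau>) \<longlonglongrightarrow> G0 \<sigma> \<tau>"
    and p: "0 \<le> p" and \<xi>: "\<xi> \<in> S \<theta>"
  shows "limitin (strong_top \<theta>) (\<lambda>n. fock_op (G n) \<xi>) (fock_op G0 \<xi>) sequentially"
  unfolding limitin_def topspace_strong_top
proof (intro conjI allI impI)
  let ?A = "fin_subsets \<times> fin_subsets"
  let ?q = "p + 2"
  have q: "0 \<le> ?q" using p by simp
  have W0: "fock_weight ?q G0 summable_on ?A"
    using G0 by (rule fock_weight_summable)
  show "fock_op G0 \<xi> \<in> Sdual \<theta>"
    by (rule fock_op_Sdual[OF W0 q \<xi>])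
  define D where "D n = infsum (fock_weight ?q (\<lambda>\<sigma> \<tau>. G n \<sigma> \<tau> - G0 \<sigma> \<tau>)) ?A" for n
  \<comment> \<open>The constant doubles by the triangle inequality, since \<open>G n\<close> and
    \<open>G0\<close> share the bound \<open>C\<close>.\<close>
  have diff: "cmod (G n \<sigma> \<tau> - G0 \<sigma> \<tau>) \<le> (2 * C) * lam \<sigma> powr p * lam \<tau> powr p"
    if "\<forall>\<sigma>\<in>fin_subsets. \<forall>\<tau>\<in>fin_subsets. cmod (G n \<sigma> \<tau>) \<le> C * lam \<sigma> powr p * lam \<tau> powr p"
      "\<sigma> \<in> fin_subsets" "\<tau> \<in> fin_subsets" for n \<sigma> \<tau>
    using norm_triangle_ineq4[of "G n \<sigma> \<tau>" "G0 \<sigma> \<tau>"] bspec[OF bspec[OF that(1,2)] that(3)]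
      G0[OF that(2,3)] by linarith
  have D: "D \<longlonglongrightarrow> 0"
    unfolding D_def
  proof (rule infsum_tendsto_0_dominated)
    fix x assume "x \<in> ?A"
    then obtain \<sigma> \<tau> where x: "x = (\<sigma>, \<tau>)" "\<sigma> \<in> fin_subsets" "\<tau> \<in> fin_subsets" by blast
    show "(\<lambda>n. fock_weight ?q (\<lambda>\<sigma> \<tau>. G n \<sigma> \<tau> - G0 \<sigma> \<tau>) x) \<longlonglongrightarrow> 0"
      unfolding fock_weight_def x(1) case_prod_conv using lim[OF x(2,3)]
      by (intro tendsto_mult_right_zero tendsto_norm_zero LIM_zero)
  next
    show "\<forall>\<^sub>F n in sequentially. \<forall>x\<in>?A. \<bar>fock_weight ?q (\<lambda>\<sigma> \<tau>. G n \<sigma> \<tau> - G0 \<sigma> \<tau>) x\<bar> \<le>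
        (2 * C) * (case x of (\<sigma>, \<tau>) \<Rightarrow> lam \<sigma> powr -2 * lam \<tau> powr -2)"
      using G
    proof eventually_elim
      case (elim n)
      show ?case
      proof
        fix x assume "x \<in> ?A"
        then obtain \<sigma> \<tau> where x: "x = (\<sigma>, \<tau>)" "\<sigma> \<in> fin_subsets" "\<tau> \<in> fin_subsets" by blast
        have "fock_weight ?q (\<lambda>\<sigma> \<tau>. G n \<sigma> \<tau> - G0 \<sigma> \<tau>) (\<sigma>, \<tau>) \<le> 2 * C * (lam \<sigma> powr -2 * lam \<tau> powr -2)"
          by (rule fock_weight_le) (rule diff[OF elim x(2,3)])
        then show "\<bar>fock_weight ?q (\<lambda>\<sigma> \<tau>. G n \<sigma> \<tau> - G0 \<sigma> \<tau>) x\<bar> \<le>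
            (2 * C) * (case x of (\<sigma>, \<tau>) \<Rightarrow> lam \<sigma> powr -2 * lam \<tau> powr -2)"
          by (simp add: x(1) fock_weight_nonneg)
      qed
    qed
    show "(\<lambda>x. (2 * C) * (case x of (\<sigma>, \<tau>) \<Rightarrow> lam \<sigma> powr -2 * lam \<tau> powr -2)) summable_on ?A"
      by (intro summable_on_cmult_right summable_lam_powr_pairs)
  qed
  fix V assume V: "openin (strong_top \<theta>) V \<and> fock_op G0 \<xi> \<in> V"
  obtain B e where B: "S_bounded \<theta> B" "e > 0"
    "\<And>\<Psi>. \<Psi> \<in> Sdual \<theta> \<Longrightarrow> (\<forall>\<eta>\<in>B. cmod (\<Psi> \<eta> - fock_op G0 \<xi> \<eta>) \<le> e) \<Longrightarrow> \<Psi> \<in> V"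
    using openin_strong_topD[OF conjunct1[OF V] conjunct2[OF V]] by blast
  obtain M where M: "M > 0" "\<And>\<eta>. \<eta> \<in> B \<Longrightarrow> Sp_norm \<theta> ?q \<eta> \<le> M"
    using S_boundedD[OF B(1) q] by blast
  \<comment> \<open>The prefactor depends on \<open>\<xi>\<close> and, through \<open>M\<close>, on
    the test set, but not on the single \<open>\<eta>\<close>.\<close>
  have "(\<lambda>n. Sp_norm \<theta> ?q \<xi> * M * D n) \<longlonglongrightarrow> 0"
    by (rule tendsto_mult_right_zero[OF D])
  then have "\<forall>\<^sub>F n in sequentially. Sp_norm \<theta> ?q \<xi> * M * D n < e"
    using B(2) by (rule order_tendstoD(2))
  with G show "\<forall>\<^sub>F n in sequentially. fock_op (G n) \<xi> \<in> V"
  proof eventually_elim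
    case (elim n)
    have W: "fock_weight ?q (G n) summable_on ?A"
      by (rule fock_weight_summable[OF bspec[OF bspec[OF elim(1)]]])
    have WD: "fock_weight ?q (\<lambda>\<sigma> \<tau>. G n \<sigma> \<tau> - G0 \<sigma> \<tau>) summable_on ?A"
      by (rule fock_weight_summable[OF diff[OF elim(1)]])
    show ?case
    proof (intro B(3) ballI fock_op_Sdual[OF W q \<xi>])
      fix \<eta> assume \<eta>B: "\<eta> \<in> B"
      then have \<eta>: "\<eta> \<in> S \<theta>" using B(1) by (auto simp: S_bounded_def)
      have "fock_op (G n) \<xi> \<eta> - fock_op G0 \<xi> \<eta> = fock_form (G n) \<xi> \<eta> - fock_form G0 \<xi> \<eta>"
        using \<xi> \<eta> by (simp add: fock_op_def)
      also have "\<dots> = fock_form (\<lambda>\<sigma> \<tau>. G n \<sigma> \<tau> - G0 \<sigma> \<tau>) \<xi> \<eta>"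
        unfolding fock_form_def
        using infsum_diff[OF fock_form_summable[OF W q \<xi> \<eta>] fock_form_summable[OF W0 q \<xi> \<eta>]]
        by (simp add: right_diff_distrib case_prod_unfold)
      finally have "cmod (fock_op (G n) \<xi> \<eta> - fock_op G0 \<xi> \<eta>) \<le>
          Sp_norm \<theta> ?q \<xi> * Sp_norm \<theta> ?q \<eta> * D n"
        using fock_form_bound[OF WD q \<xi> \<eta>] by (simp add: D_def)
      also have "\<dots> \<le> Sp_norm \<theta> ?q \<xi> * M * D n"
        unfolding D_def using M(2)[OF \<eta>B]
        by (intro mult_right_mono mult_left_mono infsum_nonneg fock_weight_nonneg Sp_norm_nonneg)
      also have "\<dots> \<le> e" using elim(2) by simp
      finally show "cmod (fock_op (G n) \<xi> \<eta> - fock_op G0 \<xi> \<eta>) \<le> e" .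
    qed
  qed
qed

end

text \<open>Smoothness supplies the witness for the choice operator; thus weak convergence may be
  tested on the densities.\<close>

lemma spectral_density_in_S:
  assumes "S_smooth \<theta> \<pi>" "\<sigma> \<in> fin_subsets" "\<tau> \<in> fin_subsets"
  shows "spectral_density \<theta> \<pi> \<sigma> \<tau> \<in> S \<theta>"
proof -
  have "\<exists>\<phi>. is_spectral_density \<theta> \<pi> \<sigma> \<tau> \<phi>" using assms unfolding S_smooth_def by blast
  then have "is_spectral_density \<theta> \<pi> \<sigma> \<tau> (spectral_density \<theta> \<pi> \<sigma> \<tau>)"
    unfolding spectral_density_def by (rule someI_ex)
  then show ?thesis by (simp add: is_spectral_density_def)
qed

theorem theorem4p5:
  fixes \<theta> :: "nat \<Rightarrow> real"
    and \<pi> :: "(nat \<Rightarrow> real) set \<Rightarrow> ((nat \<Rightarrow> real) \<Rightarrow> complex) \<Rightarrow> (nat \<Rightarrow> real) \<Rightarrow> complex"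
    and \<Phi> :: "nat \<Rightarrow> ((nat \<Rightarrow> real) \<Rightarrow> complex) \<Rightarrow> complex"
    and \<Phi>0 :: "((nat \<Rightarrow> real) \<Rightarrow> complex) \<Rightarrow> complex"
  assumes "\<And>n. 0 < \<theta> n \<and> \<theta> n < 1"
    and "spectral_measure \<theta> \<pi>"
    and "S_smooth \<theta> \<pi>"
    and "\<And>n. n \<ge> 1 \<Longrightarrow> \<Phi> n \<in> Sdual \<theta>"
    and "\<Phi>0 \<in> Sdual \<theta>"
    and "\<And>\<xi>. \<xi> \<in> S \<theta> \<Longrightarrow> (\<lambda>n. \<Phi> n \<xi>) \<longlonglongrightarrow> \<Phi>0 \<xi>"
    and "spectral_uniformly_integrable \<theta> \<pi> \<Phi> {1..}"
  shows "spectral_integrable \<theta> \<pi> \<Phi>0 \<and>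
    (\<forall>\<xi>\<in>S \<theta>. limitin (strong_top \<theta>)
       (\<lambda>n. spectral_integral \<theta> \<pi> (\<Phi> n) \<xi>) (spectral_integral \<theta> \<pi> \<Phi>0 \<xi>) sequentially)"
proof -
  interpret bernoulli_space \<theta> by standard (rule assms(1))
  obtain C p where C: "C \<ge> 0" "p \<ge> 0" and bound: "\<And>n \<sigma> \<tau>. n \<ge> 1 \<Longrightarrow> \<sigma> \<in> fin_subsets \<Longrightarrow>
      \<tau> \<in> fin_subsets \<Longrightarrow> cmod (\<Phi> n (spectral_density \<theta> \<pi> \<sigma> \<tau>)) \<le> C * lam \<sigma> powr p * lam \<tau> powr p"
    using assms(7) unfolding spectral_uniformly_integrable_def by force
  have lim: "(\<lambda>n. \<Phi> n (spectral_density \<theta> \<pi> \<sigma> \<tau>)) \<longlonglongrightarrow> \<Phi>0 (spectral_density \<theta> \<pi> \<sigma> \<tau>)"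
    if "\<sigma> \<in> fin_subsets" "\<tau> \<in> fin_subsets" for \<sigma> \<tau>
    by (rule assms(6)[OF spectral_density_in_S[OF assms(3) that]])
  \<comment> \<open>The uniform bound, valid from index 1 on, passes to the limit with the same
    constants, which yields integrability of the limit.\<close>
  have bound0: "cmod (\<Phi>0 (spectral_density \<theta> \<pi> \<sigma> \<tau>)) \<le> C * lam \<sigma> powr p * lam \<tau> powr p"
    if "\<sigma> \<in> fin_subsets" "\<tau> \<in> fin_subsets" for \<sigma> \<tau>
    using bound[OF _ that] by (intro LIMSEQ_le_const2[OF tendsto_norm[OF lim[OF that]]]) blast
  have eq0: "spectral_integral \<theta> \<pi> \<Phi>0 = fock_op (\<lambda>\<sigma> \<tau>. \<Phi>0 (spectral_density \<theta> \<pi> \<sigma> \<tau>))"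
    by (rule spectral_integral_eq[OF bound0 C(2)])
  \<comment> \<open>The sequence starts at index 1, so the bound and the formula for the spectral
    integral are claimed only for eventually all \<open>n\<close>.\<close>
  have ev: "\<forall>\<^sub>F n in sequentially. (n::nat) \<ge> 1" by (rule eventually_ge_at_top)
  show ?thesis
  proof (intro conjI ballI)
    show "spectral_integrable \<theta> \<pi> \<Phi>0"
      unfolding spectral_integrable_def using C bound0 by blast
    fix \<xi> assume "\<xi> \<in> S \<theta>"
    then have "limitin (strong_top \<theta>)
        (\<lambda>n. fock_op (\<lambda>\<sigma> \<tau>. \<Phi> n (spectral_density \<theta> \<pi> \<sigma> \<tau>)) \<xi>)
        (fock_op (\<lambda>\<sigma> \<tau>. \<Phi>0 (spectral_density \<theta> \<pi> \<sigma> \<tau>)) \<xi>) sequentially"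
      using bound bound0 lim C(2)
      by (intro fock_op_tendsto[where C = C and p = p] eventually_mono[OF ev]) auto
    moreover have "\<forall>\<^sub>F n in sequentially.
        fock_op (\<lambda>\<sigma> \<tau>. \<Phi> n (spectral_density \<theta> \<pi> \<sigma> \<tau>)) \<xi> = spectral_integral \<theta> \<pi> (\<Phi> n) \<xi>"
      using ev by eventually_elim (simp add: spectral_integral_eq[where \<pi> = \<pi>, OF bound C(2)])
    ultimately show "limitin (strong_top \<theta>) (\<lambda>n. spectral_integral \<theta> \<pi> (\<Phi> n) \<xi>)
        (spectral_integral \<theta> \<pi> \<Phi>0 \<xi>) sequentially"
      unfolding eq0 by (rule limitin_transform_eventually[rotated])
  qed
qed

end
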